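(* Let $B$ be a skew-symmetrizable exchange matrix of finite type satisfying the Standard Hypotheses and let $R$ be any underlying ring. Then the $\mathbf g$-vectors associated to $B^T$ (the set $\{\mathbf g^{B^T;t_0}_{i;t}:i\in[n],\,t\in\mathbb T_n\}$) constitute a positive $R$-basis for $B$.
   Context: **Basic conventions.** $[n]=\{1,\dots,n\}$; $[a]_+=\max(a,0)$; $\operatorname{sgn}(a)\in\{-1,0,1\}$ is the sign of $a$; $\mathbf{sgn}(\mathbf a)$ is the vector of signs of the entries of $\mathbf a$; $\mathbf{min}(\mathbf a,\mathbf 0)$ is the entrywise minimum with $0$. An *underlying ring* $R$ is either $\mathbb Z$ or a field with $\mathbb Q\subseteq R\subseteq\mathbb R$. An *exchange matrix* is an $n\times n$ integer matrix $B=(b_{ij})$ that is skew-symmetrizable: there are positive integers $d_i$ with $d_ib_{ij}=-d_jb_{ji}$ for all $i,j$. An integer extended exchange matrix has rows indexed by $[n]$ forming an exchange matrix and further integer rows. For $k\in[n]$, mutation $\mu_k$ of an (extended) exchange matrix $(b_{ij})$ gives $(b'_{ij})$ with $b'_{ij}=-b_{ij}$ if $i=k$ or $j=k$, and $b'_{ij}=b_{ij}+\operatorname{sgn}(b_{kj})[b_{ik}b_{kj}]_+$ otherwise. The mutation class of $B$ is the set of matrices obtained from $B$ by finite sequences of mutations. **Finite type.** $B$ is of *finite type* if the cluster pattern with initial exchange matrix $B$ contains only finitely many distinct seeds. This depends only on $B$, so one may use the coefficient-free pattern: seeds are pairs $((x_1,\dots,x_n),B)$ in a field $\mathbb Q(x_1,\dots,x_n)$,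 and mutation in direction $k$ replaces $B$ by $\mu_k(B)$ and $x_k$ by $x_k^{-1}\left(\prod_ix_i^{[b_{ik}]_+}+\prod_ix_i^{[-b_{ik}]_+}\right)$. **Mutation maps.** $\eta_k^B:\mathbb R^n\to\mathbb R^n$ sends $\mathbf a$ to $\mathbf a'$, where $a'_k=-a_k$ and, for $j\ne k$: $a'_j=a_j+a_kb_{kj}$ if $a_k\ge0$ and $b_{kj}\ge0$; $a'_j=a_j-a_kb_{kj}$ if $a_k\le0$ and $b_{kj}\le0$; $a'_j=a_j$ otherwise. For a finite sequence $\mathbf k=k_q,\dots,k_1$ in $[n]$, put $B_1=B$, $B_{i+1}=\mu_{k_i}(B_i)$ and $\eta^B_{\mathbf k}=\eta^{B_q}_{k_q}\circ\cdots\circ\eta^{B_1}_{k_1}$ (identity if $\mathbf k$ is empty). **Bases.** For $S$ finite, $\mathbf v_i\in\mathbb R^n$, $c_i\in R$, the formal expression $\sum_{i\in S}c_i\mathbf v_i$ is a *$B$-coherent linear relation with coefficients in $R$* if $\sum_{i\in S}c_i\eta^B_{\mathbf k}(\mathbf v_i)=\mathbf 0$ and $\sum_{i\in S}c_i\,\mathbf{min}(\eta^B_{\mathbf k}(\mathbf v_i),\mathbf 0)=\mathbf 0$ for every finite sequence $\mathbf k$ in $[n]$. A collection $(\mathbf b_i:i\in I)$ of vectors in $R^n$ is an *$R$-basis for $B$* if (i) for every $\mathbf a\in R^n$ there are a finite $S\subseteq I$ and $c_i\in R$ such that $\mathbf a-\sum_{i\in S}c_i\mathbf b_i$ is $B$-coherent;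 and (ii) every $B$-coherent linear relation $\sum_{i\in S}c_i\mathbf b_i$ with $S\subseteq I$ finite and $c_i\in R$ has all $c_i=0$. It is *positive* if for every $\mathbf a\in R^n$ the set $S$ and the $c_i$ in (i) can be chosen with all $c_i>0$. **Standard Hypotheses.** Write $\mathbf a_1\equiv^B\mathbf a_2$ if $\mathbf{sgn}(\eta^B_{\mathbf k}(\mathbf a_1))=\mathbf{sgn}(\eta^B_{\mathbf k}(\mathbf a_2))$ for every finite sequence $\mathbf k$ in $[n]$. The closures of the equivalence classes in $\mathbb R^n$ are called *$B$-cones*. Let $O=(\mathbb R_{\ge0})^n$. The Standard Hypotheses on $B$ are that both $O$ and $-O$ are $B'$-cones for every exchange matrix $B'$ in the mutation class of $B$. **$\mathbf g$-vectors.** $\mathbb T_n$ is the $n$-regular tree with edges labeled by $[n]$, each vertex incident to exactly one edge of each label; $t_0$ is a fixed vertex. For an exchange matrix $M$, let $t\mapsto\tilde M_t=(m^t_{ij})$ assign to each vertex a $2n\times n$ matrix, with $\tilde M_{t_0}$ having top $n$ rows $M$ and bottom $n$ rows the identity matrix, and $\tilde M_{t'}=\mu_k(\tilde M_t)$ when $t,t'$ are joined by an edge labeled $k$. The $\mathbf g$-vectors $\mathbf g_{\ell;t}=\mathbf g^{M;t_0}_{\ell;t}\in\mathbb Z^n$ are defined by $\mathbf g_{\ell;t_0}=\mathbf e_\ell$ (standard unit vector) and, for each edge labeled $k$ joining $t$ and $t'$: $\mathbf g_{\ell;t'}=\mathbf g_{\ell;t}$ if $\ell\neq k$, and $$\mathbf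 g_{k;t'}=-\mathbf g_{k;t}+\sum_{i=1}^n[m^t_{ik}]_+\mathbf g_{i;t}-\sum_{i=1}^n[m^t_{n+i,k}]_+\,\mathrm{col}(i,M),$$ where $\mathrm{col}(i,M)$ is the $i$th column of $M$ (it is known that this is well defined). Here $M=B^T$ is the transpose of $B$. *)

theory Defs
  imports
    "HOL-Analysis.Analysis"
    "HOL-Library.Poly_Mapping"
    "HOL-Computational_Algebra.Fraction_Field"
begin

text \<open>
  The index set \<open>[n]\<close> is a finite type \<open>'n\<close>; the entry \<open>b\<^sub>i\<^sub>j\<close> of a matrix \<open>B\<close> is \<open>B $ i $ j\<close>
  (row \<open>i\<close>, column \<open>j\<close>). A finite sequence \<open>k\<^sub>q, \<dots>, k\<^sub>1\<close>, in which \<open>k\<^sub>1\<close> acts first, is the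
  list \<open>[k\<^sub>1, \<dots>, k\<^sub>q]\<close>.
\<close>

section \<open>Exchange matrices and mutation\<close>

definition exchange_matrix :: "int ^ 'n ^ 'n \<Rightarrow> bool" where
  "exchange_matrix B \<longleftrightarrow>
     (\<exists>d :: 'n \<Rightarrow> int. (\<forall>i. 0 < d i) \<and> (\<forall>i j. d i * B $ i $ j = - (d j * B $ j $ i)))"

text \<open>
  Mutation of a matrix with columns indexed by \<open>'n\<close> and rows indexed by \<open>'m\<close>, where \<open>\<iota>\<close> embeds
  \<open>[n]\<close> into the row indices. For an exchange matrix \<open>\<iota>\<close> is the identity; for a
  \<open>2n \<times> n\<close> matrix the rows are indexed by \<open>'n + 'n\<close>, with \<open>Inl i\<close> for row \<open>i\<close> and
  \<open>Inr i\<close> for row \<open>n + i\<close>.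
\<close>

definition mutate_rows :: "('n \<Rightarrow> 'm) \<Rightarrow> 'n \<Rightarrow> int ^ 'n ^ 'm \<Rightarrow> int ^ 'n ^ 'm" where
  "mutate_rows \<iota> k M = (\<chi> i j.
     if i = \<iota> k \<or> j = k then - (M $ i $ j)
     else M $ i $ j + sgn (M $ \<iota> k $ j) * max (M $ i $ k * M $ \<iota> k $ j) 0)"

definition mutate :: "'n \<Rightarrow> int ^ 'n ^ 'n \<Rightarrow> int ^ 'n ^ 'n" where
  "mutate = mutate_rows id"

definition mutate_ext :: "'n \<Rightarrow> int ^ 'n ^ ('n + 'n) \<Rightarrow> int ^ 'n ^ ('n + 'n)" where
  "mutate_ext = mutate_rows Inl"

definition mutation_class :: "int ^ 'n ^ 'n \<Rightarrow> (int ^ 'n ^ 'n) set" where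
  "mutation_class B = {fold mutate ks B | ks. True}"

section \<open>Finite type\<close>

text \<open>
  The library makes a polynomial ring an integral domain only if its variables are linearly
  ordered. \<open>'n var\<close> is a copy of \<open>'n\<close> with some linear order, which plays no other role.
\<close>

datatype 'n var = Var (var_index: 'n)

instantiation var :: (countable) linorder
begin

definition less_eq_var :: "'a var \<Rightarrow> 'a var \<Rightarrow> bool" where
  "x \<le> y \<longleftrightarrow> to_nat (var_index x) \<le> to_nat (var_index y)"

definition less_var :: "'a var \<Rightarrow> 'a var \<Rightarrow> bool" where
  "x < y \<longleftrightarrow> to_nat (var_index x) < to_nat (var_index y)"

instance
  by standard (auto simp: less_eq_var_def less_var_def var.expand)

end

text \<open>
  The field \<open>\<rat>(x\<^sub>i : i \<in> [n])\<close>, as the fractions of polynomials with rational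
  coefficients; a monomial is given by its exponents.
\<close>

type_synonym 'n ratfun = "(('n var \<Rightarrow>\<^sub>0 nat) \<Rightarrow>\<^sub>0 rat) fract"

definition ratfun_var :: "'n :: countable \<Rightarrow> 'n ratfun" where
  "ratfun_var i = Fract (Poly_Mapping.single (Poly_Mapping.single (Var i) 1) 1) 1"

type_synonym 'n seed = "('n ratfun ^ 'n) \<times> (int ^ 'n ^ 'n)"

definition initial_seed :: "int ^ 'n ^ 'n \<Rightarrow> 'n seed" where
  "initial_seed B = ((\<chi> i. ratfun_var i), B)"

definition mutate_seed :: "'n \<Rightarrow> 'n seed \<Rightarrow> ('n :: finite) seed" where
  "mutate_seed k = (\<lambda>(x, B).
     ((\<chi> j. if j = k
           then inverse (x $ k) *
             ((\<Prod>i\<in>UNIV. (x $ i) ^ nat (max (B $ i $ k) 0)) +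
              (\<Prod>i\<in>UNIV. (x $ i) ^ nat (max (- (B $ i $ k)) 0)))
           else x $ j),
      mutate k B))"

definition finite_type :: "int ^ 'n ^ 'n \<Rightarrow> bool" where
  "finite_type B \<longleftrightarrow> finite {fold mutate_seed ks (initial_seed B) | ks. True}"

section \<open>Mutation maps\<close>

definition mutation_map :: "int ^ 'n ^ 'n \<Rightarrow> 'n \<Rightarrow> real ^ 'n \<Rightarrow> real ^ 'n" where
  "mutation_map B k a = (\<chi> j.
     if j = k then - (a $ k)
     else if a $ k \<ge> 0 \<and> B $ k $ j \<ge> 0 then a $ j + a $ k * of_int (B $ k $ j)
     else if a $ k \<le> 0 \<and> B $ k $ j \<le> 0 then a $ j - a $ k * of_int (B $ k $ j)
     else a $ j)"

fun mutation_map_seq :: "int ^ 'n ^ 'n \<Rightarrow> 'n list \<Rightarrow> real ^ 'n \<Rightarrow> real ^ 'n" where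
  "mutation_map_seq B [] = id"
| "mutation_map_seq B (k # ks) = mutation_map_seq (mutate k B) ks \<circ> mutation_map B k"

section \<open>The Standard Hypotheses\<close>

text \<open>The library's \<^const>\<open>sgn\<close> on vectors is normalisation, hence a separate entrywise sign.\<close>

definition sgn_vec :: "real ^ 'n \<Rightarrow> real ^ 'n" where
  "sgn_vec a = (\<chi> j. sgn (a $ j))"

definition B_equiv :: "int ^ 'n ^ 'n \<Rightarrow> (real ^ 'n) rel" where
  "B_equiv B = {(a\<^sub>1, a\<^sub>2).
     \<forall>ks. sgn_vec (mutation_map_seq B ks a\<^sub>1) = sgn_vec (mutation_map_seq B ks a\<^sub>2)}"

definition B_cones :: "int ^ 'n ^ 'n \<Rightarrow> (real ^ 'n) set set" where
  "B_cones B = closure ` (UNIV // B_equiv B)"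

definition nonneg_orthant :: "(real ^ 'n) set" where
  "nonneg_orthant = {a. \<forall>j. 0 \<le> a $ j}"

definition standard_hypotheses :: "int ^ 'n ^ 'n \<Rightarrow> bool" where
  "standard_hypotheses B \<longleftrightarrow> (\<forall>B' \<in> mutation_class B.
     nonneg_orthant \<in> B_cones B' \<and> uminus ` nonneg_orthant \<in> B_cones B')"

section \<open>Coherent relations and bases\<close>

definition underlying_ring :: "real set \<Rightarrow> bool" where
  "underlying_ring R \<longleftrightarrow> R = \<int> \<or>
     (\<rat> \<subseteq> R \<and> (\<forall>x\<in>R. \<forall>y\<in>R. x + y \<in> R \<and> x - y \<in> R \<and> x * y \<in> R) \<and> (\<forall>x\<in>R. x \<noteq> 0 \<longrightarrow> inverse x \<in> R))"

definition vectors_over :: "real set \<Rightarrow> (real ^ 'n) set" where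
  "vectors_over R = {a. \<forall>j. a $ j \<in> R}"

definition min_vec :: "real ^ 'n \<Rightarrow> real ^ 'n" where
  "min_vec a = (\<chi> j. min (a $ j) 0)"

text \<open>The formal expression \<open>\<Sum>i\<in>S. c\<^sub>i v\<^sub>i\<close> is given by its index set, coefficients and vectors.\<close>

definition coherent_relation ::
    "int ^ 'n ^ 'n \<Rightarrow> real set \<Rightarrow> 'i set \<Rightarrow> ('i \<Rightarrow> real) \<Rightarrow> ('i \<Rightarrow> real ^ 'n) \<Rightarrow> bool" where
  "coherent_relation B R S c v \<longleftrightarrow> finite S \<and> (\<forall>i\<in>S. c i \<in> R) \<and>
     (\<forall>ks. (\<Sum>i\<in>S. c i *\<^sub>R mutation_map_seq B ks (v i)) = 0 \<and>
           (\<Sum>i\<in>S. c i *\<^sub>R min_vec (mutation_map_seq B ks (v i))) = 0)"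

text \<open>
  Coherence of the formal expression \<open>a - (\<Sum>i\<in>S. c\<^sub>i b\<^sub>i)\<close>. Its terms are indexed by
  \<open>None\<close> (vector \<open>a\<close>, coefficient 1) and \<open>Some i\<close> for \<open>i \<in> S\<close> (vector \<open>b\<^sub>i\<close>,
  coefficient \<open>-c\<^sub>i\<close>); the terms are kept apart even if \<open>a\<close> is one of the \<open>b\<^sub>i\<close>.
\<close>

definition coherent_expansion ::
    "int ^ 'n ^ 'n \<Rightarrow> real set \<Rightarrow> real ^ 'n \<Rightarrow> 'i set \<Rightarrow> ('i \<Rightarrow> real) \<Rightarrow> ('i \<Rightarrow> real ^ 'n) \<Rightarrow> bool" where
  "coherent_expansion B R a S c b \<longleftrightarrow>
     coherent_relation B R (insert None (Some ` S)) (case_option 1 (\<lambda>i. - c i)) (case_option a b)"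

definition R_basis :: "real set \<Rightarrow> int ^ 'n ^ 'n \<Rightarrow> 'i set \<Rightarrow> ('i \<Rightarrow> real ^ 'n) \<Rightarrow> bool" where
  "R_basis R B I b \<longleftrightarrow>
     b ` I \<subseteq> vectors_over R \<and>
     (\<forall>a \<in> vectors_over R. \<exists>S c. finite S \<and> S \<subseteq> I \<and> (\<forall>i\<in>S. c i \<in> R) \<and>
        coherent_expansion B R a S c b) \<and>
     (\<forall>S c. finite S \<and> S \<subseteq> I \<and> (\<forall>i\<in>S. c i \<in> R) \<and> coherent_relation B R S c b \<longrightarrow>
        (\<forall>i\<in>S. c i = 0))"

definition positive_R_basis :: "real set \<Rightarrow> int ^ 'n ^ 'n \<Rightarrow> 'i set \<Rightarrow> ('i \<Rightarrow> real ^ 'n) \<Rightarrow> bool" where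
  "positive_R_basis R B I b \<longleftrightarrow>
     R_basis R B I b \<and>
     (\<forall>a \<in> vectors_over R. \<exists>S c. finite S \<and> S \<subseteq> I \<and> (\<forall>i\<in>S. c i \<in> R \<and> c i > 0) \<and>
        coherent_expansion B R a S c b)"

section \<open>g-vectors\<close>

text \<open>
  The vertices of the \<open>n\<close>-regular tree are the words over \<open>[n]\<close> without equal adjacent
  letters: \<open>[]\<close> is \<open>t\<^sub>0\<close>, and an edge labeled \<open>k\<close> joins \<open>w\<close> to \<open>k # w\<close> whenever both are such
  words, so each vertex lists the edge labels on its path to \<open>t\<^sub>0\<close>, most recent first. The
  recursions below follow the edges in the direction away from \<open>t\<^sub>0\<close>, which determines the
  matrices and the g-vectors at every vertex.
\<close>

definition tree_vertices :: "'n list set" where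
  "tree_vertices = {w. distinct_adj w}"

fun principal_matrix :: "int ^ 'n ^ 'n \<Rightarrow> 'n list \<Rightarrow> int ^ 'n ^ ('n + 'n)" where
  "principal_matrix M [] =
     (\<chi> r j. case r of Inl i \<Rightarrow> M $ i $ j | Inr i \<Rightarrow> (mat 1 :: int ^ 'n ^ 'n) $ i $ j)"
| "principal_matrix M (k # t) = mutate_ext k (principal_matrix M t)"

fun g_vector :: "int ^ 'n ^ 'n \<Rightarrow> 'n list \<Rightarrow> 'n \<Rightarrow> int ^ 'n" where
  "g_vector M [] l = axis l 1"
| "g_vector M (k # t) l =
     (if l \<noteq> k then g_vector M t l
      else - g_vector M t k
        + (\<Sum>i\<in>UNIV. max (principal_matrix M t $ Inl i $ k) 0 *s g_vector M t i)
        - (\<Sum>i\<in>UNIV. max (principal_matrix M t $ Inr i $ k) 0 *s column i M))"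

definition real_vec :: "int ^ 'n \<Rightarrow> real ^ 'n" where
  "real_vec v = (\<chi> j. of_int (v $ j))"

definition g_vectors :: "int ^ 'n ^ 'n \<Rightarrow> (real ^ 'n) set" where
  "g_vectors M = {real_vec (g_vector M t l) | l t. t \<in> tree_vertices}"

end

theory Submission
  imports Defs
begin

text \<open>
  Write \<open>\<eta>\<close> for a composite of mutation maps and \<open>O\<close> for the nonnegative orthant. The Standard
  Hypotheses make \<open>O\<close> and \<open>-O\<close> closures of classes for every matrix in the mutation class, so
  each coordinate of each \<open>\<eta>\<close> has a constant weak sign on \<open>O\<close> and on \<open>-O\<close>
  (\<open>sign_coherent\<close>). Mutation maps are linear where one coordinate has constant sign, so every
  \<open>\<eta>\<close> is linear on \<open>O\<close>. A sequence of mutations \<open>ks\<close> thus gives a simplicial cone, the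
  preimage of \<open>O\<close>, spanned by the vectors \<open>chart_ray B ks l\<close> that \<open>\<eta>\<close> sends to the
  unit vectors. The theorem says that these are the g-vectors, that the cones cover the space, and
  that the rays satisfy no nontrivial coherent relation.

  \<^bold>\<open>Covering.\<close> Starting from a vector \<open>a\<close>, mutate at any negative coordinate for as long as there
  is one. To see that this stops, evaluate the cluster variables at a positive point \<open>x\<close> and follow
  \<open>Q = (\<Sum>j. a\<^sub>j ln x\<^sub>j / d\<^sub>j)\<close>. A mutation at a negative coordinate of \<open>a\<close> strictly increases \<open>Q\<close>,
  whatever \<open>x\<close> is. If a seed occurred twice, one could choose the initial point such that the
  clusters at both occurrences evaluate to \<open>(1,\<dots>,1)\<close>, and then \<open>Q = 0\<close> twice. So no seed repeats,
  and in finite type the process ends with \<open>a\<close> in the cone of the chart that is reached. Because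
  \<open>\<eta>\<close> is linear on \<open>O\<close>, the expansion of \<open>a\<close> in the rays of that cone is coherent; its coefficients
  are the coordinates of \<open>\<eta> a\<close>, which are nonnegative and lie in \<open>R\<close>
  (\<open>directed_terminates\<close>, \<open>chart_expansion\<close>).

  \<^bold>\<open>The rays are g-vectors.\<close> Let \<open>L\<close> be the linear map that agrees with \<open>\<eta>\<close> on \<open>-O\<close>. By
  skew-symmetrizability the c-vectors of the transposed matrix are, up to scaling, the
  coordinate functionals of \<open>L\<close>, so they are sign-coherent. The essential point is that \<open>L\<close> also
  agrees with \<open>\<eta>\<close> on the cone of the chart (\<open>dual_basis\<close>). It rests on
  \<open>wall_crossing\<close>, which says how \<open>\<eta>\<close> bends across a wall of that cone: not at all or by one
  row of the current matrix, according to the sign of the normal vector of the wall. These two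
  cases are the two forms of the g-vector recursion (\<open>g_vector_eq_chart_ray\<close>).

  \<^bold>\<open>Independence.\<close> Let the ray \<open>r\<close> occur in a coherent relation. Pass to a chart in which \<open>r\<close> is the
  unit vector \<open>e\<^sub>k\<close>. Mutations in other directions preserve this, and the row \<open>k\<close> of the
  matrix itself moves by mutation maps, so the termination argument leads to a chart whose
  row \<open>k\<close> has no positive entry. In such a chart \<open>e\<^sub>k\<close> is the only ray with a positive
  coordinate \<open>k\<close> (\<open>sink_ray\<close>), so the positive parts of the coordinates \<open>k\<close> isolate the
  coefficient of \<open>r\<close>.
\<close>

section \<open>Mutation of matrices and of vectors\<close>

definition symmetrizes :: "('n \<Rightarrow> int) \<Rightarrow> int ^ 'n ^ 'n \<Rightarrow> bool" where
  "symmetrizes d B \<longleftrightarrow> (\<forall>i. 0 < d i) \<and> (\<forall>i j. d i * B $ i $ j = - (d j * B $ j $ i))"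

lemma symmetrizesD:
  assumes "symmetrizes d B"
  shows "0 < d i" "d i * B $ i $ j = - (d j * B $ j $ i)"
  by (rule assms[unfolded symmetrizes_def, THEN conjunct1, THEN spec],
      rule assms[unfolded symmetrizes_def, THEN conjunct2, THEN spec, THEN spec])

lemma diagonal_zero: "symmetrizes d B \<Longrightarrow> B $ k $ k = 0"
proof -
  assume "symmetrizes d B"
  then have "d k * B $ k $ k = - (d k * B $ k $ k)" "d k > 0"
    by (rule symmetrizesD(2), rule symmetrizesD(1))
  then have "d k * B $ k $ k = 0" "d k > 0" by linarith+
  then show ?thesis by simp
qed

lemma sign_transpose:
  assumes "symmetrizes d B"
  shows "B $ i $ j > 0 \<longleftrightarrow> B $ j $ i < 0"
proof -
  have "B $ i $ j > 0 \<longleftrightarrow> d i * B $ i $ j > 0"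
    using symmetrizesD(1)[OF assms, of i] by (simp add: zero_less_mult_iff)
  also have "\<dots> \<longleftrightarrow> d j * B $ j $ i < 0"
    using symmetrizesD(2)[OF assms, of i j] by linarith
  also have "\<dots> \<longleftrightarrow> B $ j $ i < 0"
    using symmetrizesD(1)[OF assms, of j] by (simp add: mult_less_0_iff)
  finally show ?thesis .
qed

lemma sign_transpose_le:
  assumes "symmetrizes d B"
  shows "B $ i $ j \<le> 0 \<longleftrightarrow> B $ j $ i \<ge> 0"
  using sign_transpose[OF assms, of i j] by linarith

lemma scaled_pos_part:
  fixes p q x y :: int
  assumes "p * x = - (q * y)" "p > 0" "q > 0"
  shows "p * max x 0 = q * max (- y) 0"
proof -
  have "p * max x 0 = max (p * x) 0" using assms(2) by (simp add: max_mult_distrib_left)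
  also have "\<dots> = max (q * (- y)) 0" using assms(1) by simp
  also have "\<dots> = q * max (- y) 0" using assms(3) by (simp add: max_mult_distrib_left)
  finally show ?thesis .
qed

lemma mutate_nth:
  "mutate k B $ i $ j = (if i = k \<or> j = k then - (B $ i $ j)
     else B $ i $ j + sgn (B $ k $ j) * max (B $ i $ k * B $ k $ j) 0)"
  by (simp add: mutate_def mutate_rows_def)

text \<open>
  The correction term of matrix mutation can be written with either sign \<open>s\<close>. The freedom to
  choose \<open>s\<close> lets one match the linear piece of a mutation map that is in force.
\<close>

lemma mutation_term:
  fixes s x y :: int
  assumes "s = 1 \<or> s = -1"
  shows "sgn y * max (x * y) 0 = x * max (s * y) 0 + max (- s * x) 0 * y"
  using assms
  by (cases "x > 0"; cases "y > 0"; cases "x = 0"; cases "y = 0")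
     (auto simp: max_def sgn_if mult_le_0_iff zero_le_mult_iff)

lemma symmetrizes_mutate:
  assumes "symmetrizes d B"
  shows "symmetrizes d (mutate k B)"
  unfolding symmetrizes_def
proof (intro conjI allI)
  fix i j
  note D = symmetrizesD[OF assms]
  show "0 < d i" by (rule D)
  show "d i * mutate k B $ i $ j = - (d j * mutate k B $ j $ i)"
  proof (cases "i = k \<or> j = k")
    case True
    then show ?thesis using D(2)[of i j] by (auto simp: mutate_nth)
  next
    case False
    have e: "d i * (B $ i $ k * max (B $ k $ j) 0) = - (d j * (max (- (B $ j $ k)) 0 * B $ k $ i))"
    proof -
      have "d i * (B $ i $ k * max (B $ k $ j) 0) = - (d k * max (B $ k $ j) 0) * B $ k $ i"
        using arg_cong[OF D(2)[of i k], of "\<lambda>u. u * max (B $ k $ j) 0"] by (simp add: mult_ac)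
      also have "d k * max (B $ k $ j) 0 = d j * max (- (B $ j $ k)) 0"
        by (rule scaled_pos_part) (auto intro: D)
      finally show ?thesis by (simp add: algebra_simps)
    qed
    have f: "d i * (max (- (B $ i $ k)) 0 * B $ k $ j) = - (d j * (B $ j $ k * max (B $ k $ i) 0))"
    proof -
      have "d j * (B $ j $ k * max (B $ k $ i) 0) = - (d k * max (B $ k $ i) 0) * B $ k $ j"
        using arg_cong[OF D(2)[of j k], of "\<lambda>u. u * max (B $ k $ i) 0"] by (simp add: mult_ac)
      also have "d k * max (B $ k $ i) 0 = d i * max (- (B $ i $ k)) 0"
        by (rule scaled_pos_part) (auto intro: D)
      finally show ?thesis by (simp add: algebra_simps)
    qed
    show ?thesis
      using False D(2)[of i j] e f
      by (simp add: mutate_nth mutation_term[where s = 1] distrib_left)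
  qed
qed

lemma symmetrizes_fold_mutate:
  "symmetrizes d B \<Longrightarrow> symmetrizes d (fold mutate ks B)"
  by (induction ks arbitrary: B) (simp_all add: symmetrizes_mutate)

lemma mutate_mutate: "mutate k (mutate k B) = B"
  by (simp add: vec_eq_iff mutate_nth sgn_if)

lemma fold_mutate_rev: "fold mutate (rev ks) (fold mutate ks B) = B"
  by (induction ks arbitrary: B) (simp_all add: mutate_mutate)

text \<open>
  The two linear pieces of a mutation map: \<open>s = 1\<close> is valid for \<open>a $ k \<ge> 0\<close> and
  \<open>s = -1\<close> for \<open>a $ k \<le> 0\<close>.
\<close>

definition mutation_piece :: "int \<Rightarrow> int ^ 'n ^ 'n \<Rightarrow> 'n \<Rightarrow> real ^ 'n \<Rightarrow> real ^ 'n" where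
  "mutation_piece s B k a = (\<chi> j. if j = k then - (a $ k)
     else a $ j + a $ k * of_int (max (s * B $ k $ j) 0))"

lemma mutation_map_nonneg: "0 \<le> a $ k \<Longrightarrow> mutation_map B k a = mutation_piece 1 B k a"
  by (auto simp: vec_eq_iff mutation_map_def mutation_piece_def max_def)

lemma mutation_map_nonpos: "a $ k \<le> 0 \<Longrightarrow> mutation_map B k a = mutation_piece (-1) B k a"
  by (auto simp: vec_eq_iff mutation_map_def mutation_piece_def max_def)

lemma linear_mutation_piece: "linear (mutation_piece s B k)"
  by (rule linearI) (auto simp: vec_eq_iff mutation_piece_def algebra_simps)

text \<open>
  The bend of a mutation map at its wall is the row \<open>k\<close> of the matrix.
\<close>

lemma mutation_piece_diff:
  assumes "B $ k $ k = 0"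
  shows "mutation_piece 1 B k a = mutation_piece (-1) B k a + a $ k *\<^sub>R real_vec (B $ k)"
  using assms by (auto simp: vec_eq_iff mutation_piece_def real_vec_def max_def algebra_simps)

lemma mutation_map_nth:
  "mutation_map B k a $ j = (if j = k then - (a $ k)
     else a $ j + max (a $ k) 0 * of_int (max (B $ k $ j) 0)
                + min (a $ k) 0 * of_int (max (- (B $ k $ j)) 0))"
  by (cases "0 \<le> a $ k")
     (auto simp: mutation_map_nonneg mutation_map_nonpos mutation_piece_def min_def max_def)

lemma mutation_map_mutation_map: "mutation_map (mutate k B) k (mutation_map B k a) = a"
proof -
  have "mutate k B $ k $ j = - (B $ k $ j)" for j by (simp add: mutate_nth)
  then show ?thesis
    by (cases "0 \<le> a $ k") (auto simp: vec_eq_iff mutation_map_nth min_def max_def)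
qed

lemma mutation_map_seq_append:
  "mutation_map_seq B (ks @ ls) = mutation_map_seq (fold mutate ks B) ls \<circ> mutation_map_seq B ks"
  by (induction ks arbitrary: B) auto

lemma mutation_map_seq_snoc:
  "mutation_map_seq B (ks @ [k]) a = mutation_map (fold mutate ks B) k (mutation_map_seq B ks a)"
  by (simp add: mutation_map_seq_append)

lemma mutation_map_seq_rev:
  "mutation_map_seq (fold mutate ks B) (rev ks) (mutation_map_seq B ks a) = a"
  by (induction ks arbitrary: B a)
     (simp_all add: mutation_map_seq_append fold_mutate_rev mutation_map_mutation_map)

lemma mutation_map_seq_rev':
  "mutation_map_seq B ks (mutation_map_seq (fold mutate ks B) (rev ks) a) = a"
  using mutation_map_seq_rev[where B = "fold mutate ks B" and ks = "rev ks" and a = a]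
  by (simp add: fold_mutate_rev)

lemma mutation_map_seq_eq_iff: "mutation_map_seq B ks a = mutation_map_seq B ks b \<longleftrightarrow> a = b"
  using mutation_map_seq_rev by metis

lemma mutation_map_scaleR:
  "0 \<le> c \<Longrightarrow> mutation_map B k (c *\<^sub>R a) = c *\<^sub>R mutation_map B k a"
  using linear_scale[OF linear_mutation_piece]
  by (cases "0 \<le> a $ k")
     (auto simp: mutation_map_nonneg mutation_map_nonpos mult_nonneg_nonpos)

lemma mutation_map_seq_scaleR:
  "0 \<le> c \<Longrightarrow> mutation_map_seq B ks (c *\<^sub>R a) = c *\<^sub>R mutation_map_seq B ks a"
  by (induction ks arbitrary: B a) (auto simp: mutation_map_scaleR)

lemma mutation_map_seq_zero [simp]: "mutation_map_seq B ks 0 = 0"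
  using mutation_map_seq_scaleR[of 0 B ks 0] by simp

lemma continuous_on_mutation_map_nth:
  "continuous_on UNIV (\<lambda>a. mutation_map B k a $ j)"
  unfolding mutation_map_nth by (cases "j = k"; simp; intro continuous_intros)

lemma continuous_on_mutation_map: "continuous_on UNIV (mutation_map B k)"
  using continuous_on_vec_lambda[of UNIV "\<lambda>j a. mutation_map B k a $ j"]
    continuous_on_mutation_map_nth by auto

lemma continuous_on_mutation_map_seq: "continuous_on UNIV (mutation_map_seq B ks)"
  by (induction ks arbitrary: B)
     (auto intro!: continuous_on_compose2[OF _ continuous_on_mutation_map] simp: o_def)

text \<open>
  Two instances matter: \<open>s = 1\<close>, and \<open>s = d\<close>, where skew-symmetrizability
  \<open>d i * B $ i $ j = - d j * B $ j $ i\<close> provides the divisibility. The second one serves to compare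
  the entries of \<open>d\<close> along a path of mutations.
\<close>

lemma mutation_map_seq_lattice:
  fixes R :: "real set" and s :: "'n::finite \<Rightarrow> real"
  assumes add: "\<And>x y. x \<in> R \<Longrightarrow> y \<in> R \<Longrightarrow> x + y \<in> R"
    and minus: "\<And>x. x \<in> R \<Longrightarrow> - x \<in> R"
    and times: "\<And>x z. x \<in> R \<Longrightarrow> x * of_int z \<in> R"
    and s: "\<And>B i j. symmetrizes d B \<Longrightarrow> \<exists>z. s i * of_int (B $ i $ j) = s j * of_int z"
    and s0: "\<And>i. s i > 0"
    and B: "symmetrizes d B" and a: "\<And>j. a $ j / s j \<in> R"
  shows "mutation_map_seq B ks a $ j / s j \<in> R"
  using B a
proof (induction ks arbitrary: B a j)
  case (Cons k ks)
  have step: "mutation_piece e B k a $ j / s j \<in> R" for e j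
  proof (cases "j = k")
    case True
    then show ?thesis using minus[OF Cons.prems(2)[of k]] by (simp add: mutation_piece_def)
  next
    case False
    obtain z where z: "s k * of_int (B $ k $ j) = s j * of_int z"
      using s[OF Cons.prems(1)] by blast
    have "\<exists>z'. s k * of_int (max (e * B $ k $ j) 0) = s j * of_int z'"
    proof (cases "e * B $ k $ j \<ge> 0")
      case True
      then have m: "max (e * B $ k $ j) 0 = e * B $ k $ j" by simp
      have "s k * of_int (e * B $ k $ j) = of_int e * (s k * of_int (B $ k $ j))" by simp
      then have "s k * of_int (e * B $ k $ j) = s j * of_int (e * z)" unfolding z by simp
      then show ?thesis unfolding m by blast
    next
      case False
      then show ?thesis by (intro exI[of _ 0]) (simp add: max_def)
    qed
    then obtain z' where z': "s k * of_int (max (e * B $ k $ j) 0) = s j * of_int z'" by blast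
    have "a $ k * of_int (max (e * B $ k $ j) 0) / s j = a $ k / s k * of_int z'"
      using z' s0[of k] s0[of j] by (simp add: field_simps)
    then show ?thesis
      using False add[OF Cons.prems(2)[of j] times[OF Cons.prems(2)[of k], of z']]
      by (simp add: mutation_piece_def add_divide_distrib)
  qed
  have "mutation_map B k a $ j / s j \<in> R" for j
    using step by (cases "0 \<le> a $ k") (auto simp: mutation_map_nonneg mutation_map_nonpos)
  then show ?case
    using Cons.IH[OF symmetrizes_mutate[OF Cons.prems(1)]] by simp
qed auto

lemma mutation_map_seq_over_ring:
  assumes "underlying_ring R" "symmetrizes d B" "a \<in> vectors_over R"
  shows "mutation_map_seq B ks a \<in> vectors_over R"
proof -
  have Z: "of_int z \<in> R" for z
    using assms(1) by (auto simp: underlying_ring_def)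
  have cl: "x + y \<in> R" "x * y \<in> R" "x - y \<in> R" if "x \<in> R" "y \<in> R" for x y
    using assms(1) that by (auto simp: underlying_ring_def)
  have "mutation_map_seq B ks a $ j / 1 \<in> R" for j
  proof (rule mutation_map_seq_lattice[where s = "\<lambda>_. 1" and d = d])
    show "- x \<in> R" if "x \<in> R" for x using cl(3)[OF Z[of 0] that] by simp
  qed (use assms(2,3) cl Z in \<open>auto simp: vectors_over_def\<close>)
  then show ?thesis by (simp add: vectors_over_def)
qed

lemma underlying_ring_Ints: "underlying_ring \<int>"
  by (simp add: underlying_ring_def)

lemma mutation_map_seq_Ints:
  assumes "symmetrizes d B" "\<And>j. a $ j \<in> \<int>"
  shows "mutation_map_seq B ks a $ j \<in> \<int>"
  using mutation_map_seq_over_ring[OF underlying_ring_Ints assms(1), of a ks] assms(2)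
  by (simp add: vectors_over_def)

lemma mutation_map_seq_scaled_Ints:
  assumes "symmetrizes d B" "\<And>j. a $ j / of_int (d j) \<in> \<int>"
  shows "mutation_map_seq B ks a $ j / of_int (d j) \<in> \<int>"
proof (rule mutation_map_seq_lattice[where s = "\<lambda>i. of_int (d i)" and d = d])
  fix B :: "int ^ 'a ^ 'a" and i j assume "symmetrizes d B"
  from symmetrizesD(2)[OF this, of i j]
  have "real_of_int (d i * B $ i $ j) = of_int (- (d j * B $ j $ i))" by (simp only:)
  then show "\<exists>z. real_of_int (d i) * of_int (B $ i $ j) = of_int (d j) * of_int z"
    by (intro exI[of _ "- (B $ j $ i)"]) simp
qed (use assms symmetrizesD in auto)

lemma mutation_map_axis:
  "m \<noteq> k \<Longrightarrow> mutation_map B m (axis k c) = axis k c"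
  by (simp add: vec_eq_iff mutation_map_nth axis_def)

lemma mutation_map_seq_axis:
  "k \<notin> set ks \<Longrightarrow> mutation_map_seq B ks (axis k c) = axis k c"
  by (induction ks arbitrary: B) (auto simp: mutation_map_axis)

text \<open>
  Rows of an extended matrix transform by mutation maps. A row of the exchange matrix itself does so
  as well, as long as its own index is not mutated.
\<close>

lemma mutation_map_row:
  assumes "symmetrizes d B" "m \<noteq> k"
  shows "mutation_map B m (real_vec (B $ k)) = real_vec (mutate m B $ k)"
proof -
  have eq: "mutation_map B m (real_vec (B $ k)) $ j = real_vec (mutate m B $ k) $ j" for j
  proof (cases "j = m")
    case True
    then show ?thesis using assms(2) by (simp add: mutation_map_nth real_vec_def mutate_nth)
  next
    case False
    have "sgn (B $ m $ j) * max (B $ k $ m * B $ m $ j) 0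
        = max (B $ k $ m) 0 * max (B $ m $ j) 0 + min (B $ k $ m) 0 * max (- (B $ m $ j)) 0"
      by (cases "B $ k $ m" "0::int" rule: linorder_cases; cases "B $ m $ j" "0::int" rule: linorder_cases)
         (auto simp: max_def min_def sgn_if algebra_simps mult_le_0_iff zero_le_mult_iff not_le)
    then have "real_of_int (sgn (B $ m $ j) * max (B $ k $ m * B $ m $ j) 0)
        = max (of_int (B $ k $ m)) 0 * of_int (max (B $ m $ j) 0)
          + min (of_int (B $ k $ m)) 0 * of_int (max (- (B $ m $ j)) 0)"
      by (simp add: of_int_max of_int_min)
    then show ?thesis
      using False assms(2) by (simp add: mutation_map_nth real_vec_def mutate_nth del: of_int_mult)
  qed
  then show ?thesis by (simp add: vec_eq_iff)
qed

lemma mutation_map_seq_row: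
  "symmetrizes d B \<Longrightarrow> k \<notin> set ks \<Longrightarrow>
    mutation_map_seq B ks (real_vec (B $ k)) = real_vec (fold mutate ks B $ k)"
proof (induction ks arbitrary: B)
  case (Cons m ks)
  then show ?case
    using mutation_map_row[of d B m k] symmetrizes_mutate[of d B m] by auto
qed auto

section \<open>Values of cluster variables at positive points\<close>

definition monomial_at :: "real ^ 'n \<Rightarrow> ('n var \<Rightarrow>\<^sub>0 nat) \<Rightarrow> real" where
  "monomial_at x m = (\<Prod>i\<in>UNIV. (x $ i) ^ Poly_Mapping.lookup m (Var i))"

definition poly_at :: "real ^ 'n \<Rightarrow> (('n var \<Rightarrow>\<^sub>0 nat) \<Rightarrow>\<^sub>0 rat) \<Rightarrow> real" where
  "poly_at x p = (\<Sum>m\<in>Poly_Mapping.keys p. of_rat (Poly_Mapping.lookup p m) * monomial_at x m)"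

lemma monomial_at_add: "monomial_at x (m + m') = monomial_at x m * monomial_at x m'"
  by (simp add: monomial_at_def lookup_add power_add prod.distrib)

lemma poly_at_superset:
  assumes "finite A" "Poly_Mapping.keys p \<subseteq> A"
  shows "poly_at x p = (\<Sum>m\<in>A. of_rat (Poly_Mapping.lookup p m) * monomial_at x m)"
  unfolding poly_at_def
  by (rule sum.mono_neutral_left) (use assms in \<open>auto simp: in_keys_iff\<close>)

lemma poly_at_add: "poly_at x (p + q) = poly_at x p + poly_at x q"
proof -
  let ?A = "Poly_Mapping.keys p \<union> Poly_Mapping.keys q"
  have "poly_at x r = (\<Sum>m\<in>?A. of_rat (Poly_Mapping.lookup r m) * monomial_at x m)"
    if "r \<in> {p, q, p + q}" for r
    by (rule poly_at_superset) (use that keys_add[of p q] in auto)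
  then show ?thesis
    by (simp add: lookup_add of_rat_add distrib_right sum.distrib)
qed

lemma poly_at_zero [simp]: "poly_at x 0 = 0"
  by (simp add: poly_at_def)

lemma poly_at_sum: "poly_at x (sum f A) = (\<Sum>a\<in>A. poly_at x (f a))"
  by (induction A rule: infinite_finite_induct) (auto simp: poly_at_add)

lemma poly_at_single: "poly_at x (Poly_Mapping.single m c) = of_rat c * monomial_at x m"
  by (cases "c = 0") (auto simp: poly_at_def)

lemma poly_mapping_eq_sum_single:
  "p = (\<Sum>m\<in>Poly_Mapping.keys p. Poly_Mapping.single m (Poly_Mapping.lookup p m))"
  by (rule poly_mapping_eqI)
     (auto simp: lookup_sum lookup_single when_def in_keys_iff)

lemma poly_at_mult: "poly_at x (p * q) = poly_at x p * poly_at x q"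
proof -
  let ?s = "\<lambda>p m. Poly_Mapping.single m (Poly_Mapping.lookup p m)"
  have "p * q = (\<Sum>m\<in>Poly_Mapping.keys p. ?s p m) * (\<Sum>m\<in>Poly_Mapping.keys q. ?s q m)"
    using poly_mapping_eq_sum_single[of p] poly_mapping_eq_sum_single[of q] by simp
  then have "poly_at x (p * q) =
      (\<Sum>m\<in>Poly_Mapping.keys p. \<Sum>m'\<in>Poly_Mapping.keys q. poly_at x (?s p m * ?s q m'))"
    by (simp add: sum_product poly_at_sum)
  also have "\<dots> = (\<Sum>m\<in>Poly_Mapping.keys p. \<Sum>m'\<in>Poly_Mapping.keys q.
      (of_rat (Poly_Mapping.lookup p m) * monomial_at x m)
        * (of_rat (Poly_Mapping.lookup q m') * monomial_at x m'))"
    by (simp only: mult_single poly_at_single monomial_at_add of_rat_mult mult_ac)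
  also have "\<dots> = poly_at x p * poly_at x q"
    by (simp only: poly_at_def sum_product)
  finally show ?thesis .
qed

lemma poly_at_one [simp]: "poly_at x 1 = 1"
  unfolding single_one[symmetric] poly_at_single by (simp add: monomial_at_def)

definition positive_vec :: "real ^ 'n \<Rightarrow> bool" where
  "positive_vec x \<longleftrightarrow> (\<forall>i. 0 < x $ i)"

text \<open>
  Cluster variables are obtained without subtraction, so they can be evaluated at every positive
  point: some representing fraction has a positive numerator and denominator at all of them.
  Asking for such a fraction makes the values depend on the rational function only
  (\<open>has_values_unique\<close>), which an arbitrary representative would not guarantee at its poles.
\<close>

definition has_values :: "('n :: finite) ratfun \<Rightarrow> (real ^ 'n \<Rightarrow> real) \<Rightarrow> bool" where
  "has_values X f \<longleftrightarrow> (\<exists>p q. X = Fract p q \<and>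
     (\<forall>x. positive_vec x \<longrightarrow> 0 < poly_at x p \<and> 0 < poly_at x q \<and> f x = poly_at x p / poly_at x q))"

lemma positive_vec_one: "positive_vec 1"
  by (simp add: positive_vec_def)

lemma poly_nonzero: "(\<forall>x. positive_vec x \<longrightarrow> 0 < poly_at x p) \<Longrightarrow> p \<noteq> 0"
  using positive_vec_one by fastforce

lemma has_values_unique:
  assumes "has_values X f" "has_values X g" "positive_vec x"
  shows "f x = g x"
proof -
  obtain p q p' q' where X: "X = Fract p q" "X = Fract p' q'"
    and f: "\<forall>x. positive_vec x \<longrightarrow> 0 < poly_at x p \<and> 0 < poly_at x q \<and> f x = poly_at x p / poly_at x q"
    and g: "\<forall>x. positive_vec x \<longrightarrow> 0 < poly_at x p' \<and> 0 < poly_at x q' \<and> g x = poly_at x p' / poly_at x q'"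
    using assms(1,2) unfolding has_values_def by metis
  have "q \<noteq> 0" "q' \<noteq> 0" using f g poly_nonzero by blast+
  then have "p * q' = p' * q" using X by (simp add: eq_fract)
  then have "poly_at x p * poly_at x q' = poly_at x p' * poly_at x q"
    using poly_at_mult by metis
  moreover have "poly_at x q \<noteq> 0" "poly_at x q' \<noteq> 0" using f g assms(3) less_irrefl by metis+
  ultimately show ?thesis
    using f g assms(3) by (simp add: frac_eq_eq)
qed

lemma has_values_var: "has_values (ratfun_var i) (\<lambda>x. x $ i)"
proof -
  have "monomial_at x (Poly_Mapping.single (Var i) 1) = x $ i" for x :: "real ^ 'a"
    by (simp add: monomial_at_def lookup_single when_def if_distrib if_distribR cong: if_cong)
  then show ?thesis
    unfolding has_values_def ratfun_var_def
    by (intro exI conjI) (rule refl, auto simp: poly_at_single positive_vec_def)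
qed

lemma has_values_one: "has_values 1 (\<lambda>x. 1)"
  unfolding has_values_def One_fract_def by (intro exI conjI) (rule refl, auto)

lemma has_values_mult:
  assumes "has_values X f" "has_values Y g"
  shows "has_values (X * Y) (\<lambda>x. f x * g x)"
proof -
  obtain p q p' q' where X: "X = Fract p q" "Y = Fract p' q'"
    and f: "\<forall>x. positive_vec x \<longrightarrow> 0 < poly_at x p \<and> 0 < poly_at x q \<and> f x = poly_at x p / poly_at x q"
    and g: "\<forall>x. positive_vec x \<longrightarrow> 0 < poly_at x p' \<and> 0 < poly_at x q' \<and> g x = poly_at x p' / poly_at x q'"
    using assms(1,2) unfolding has_values_def by metis
  have "X * Y = Fract (p * p') (q * q')" using X by simp
  then show ?thesis
    unfolding has_values_def using f g
    by (intro exI[of _ "p * p'"] exI[of _ "q * q'"]) (simp add: poly_at_mult)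
qed

lemma has_values_add:
  assumes "has_values X f" "has_values Y g"
  shows "has_values (X + Y) (\<lambda>x. f x + g x)"
proof -
  obtain p q p' q' where X: "X = Fract p q" "Y = Fract p' q'"
    and f: "\<forall>x. positive_vec x \<longrightarrow> 0 < poly_at x p \<and> 0 < poly_at x q \<and> f x = poly_at x p / poly_at x q"
    and g: "\<forall>x. positive_vec x \<longrightarrow> 0 < poly_at x p' \<and> 0 < poly_at x q' \<and> g x = poly_at x p' / poly_at x q'"
    using assms(1,2) unfolding has_values_def by metis
  have "q \<noteq> 0" "q' \<noteq> 0" using f g poly_nonzero by blast+
  then have "X + Y = Fract (p * q' + p' * q) (q * q')" using X by simp
  moreover have "0 < poly_at x (p * q' + p' * q) \<and> 0 < poly_at x (q * q') \<and>
      f x + g x = poly_at x (p * q' + p' * q) / poly_at x (q * q')" if "positive_vec x" for x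
  proof -
    have p: "0 < poly_at x p" "0 < poly_at x q" "0 < poly_at x p'" "0 < poly_at x q'"
      using f g that by auto
    then have "poly_at x q \<noteq> 0" "poly_at x q' \<noteq> 0" by auto
    with p f g that show ?thesis
      by (simp add: poly_at_mult poly_at_add add_pos_pos add_frac_eq)
  qed
  ultimately show ?thesis
    unfolding has_values_def by blast
qed

lemma has_values_inverse:
  assumes "has_values X f"
  shows "has_values (inverse X) (\<lambda>x. inverse (f x))"
proof -
  obtain p q where X: "X = Fract p q"
    and f: "\<forall>x. positive_vec x \<longrightarrow> 0 < poly_at x p \<and> 0 < poly_at x q \<and> f x = poly_at x p / poly_at x q"
    using assms unfolding has_values_def by metis
  have "inverse X = Fract q p" using X by simp
  then show ?thesis
    unfolding has_values_def using f
    by (intro exI[of _ q] exI[of _ p]) simp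
qed

lemma has_values_power: "has_values X f \<Longrightarrow> has_values (X ^ m) (\<lambda>x. f x ^ m)"
  by (induction m) (auto intro: has_values_one has_values_mult)

lemma has_values_prod:
  "(\<And>i. has_values (X i) (f i)) \<Longrightarrow> has_values (\<Prod>i\<in>A. X i) (\<lambda>x. \<Prod>i\<in>A. f i x)"
  by (induction A rule: infinite_finite_induct) (auto intro: has_values_one has_values_mult)

definition exchange_monomial :: "int \<Rightarrow> int ^ 'n ^ 'n \<Rightarrow> 'n \<Rightarrow> real ^ 'n \<Rightarrow> real" where
  "exchange_monomial s B k x = (\<Prod>i\<in>UNIV. (x $ i) ^ nat (max (s * B $ i $ k) 0))"

definition cluster_map :: "int ^ 'n ^ 'n \<Rightarrow> 'n \<Rightarrow> real ^ 'n \<Rightarrow> real ^ 'n" where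
  "cluster_map B k x = (\<chi> j. if j = k
     then inverse (x $ k) * (exchange_monomial 1 B k x + exchange_monomial (-1) B k x)
     else x $ j)"

fun cluster_map_seq :: "int ^ 'n ^ 'n \<Rightarrow> 'n list \<Rightarrow> real ^ 'n \<Rightarrow> real ^ 'n" where
  "cluster_map_seq B [] = id"
| "cluster_map_seq B (k # ks) = cluster_map_seq (mutate k B) ks \<circ> cluster_map B k"

lemma cluster_map_seq_append:
  "cluster_map_seq B (ks @ ls) = cluster_map_seq (fold mutate ks B) ls \<circ> cluster_map_seq B ks"
  by (induction ks arbitrary: B) auto

lemma seed_values:
  assumes "\<And>j. has_values (X $ j) (\<lambda>x. F x $ j)"
  shows "has_values (fst (fold mutate_seed ks (X, B)) $ j) (\<lambda>x. cluster_map_seq B ks (F x) $ j)"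
  using assms
proof (induction ks arbitrary: X B F j)
  case (Cons k ks)
  define X' where "X' = fst (mutate_seed k (X, B))"
  have "mutate_seed k (X, B) = (X', mutate k B)"
    by (simp add: X'_def mutate_seed_def)
  moreover have "has_values (X' $ i) (\<lambda>x. cluster_map B k (F x) $ i)" for i
    using Cons.prems
    by (auto simp: X'_def mutate_seed_def cluster_map_def exchange_monomial_def
        intro!: has_values_mult has_values_inverse has_values_add has_values_prod has_values_power)
  ultimately show ?case
    using Cons.IH by simp
qed auto

text \<open>
  The only link between the field of rational functions and real numbers: it turns equality of seeds
  into equality of maps on the positive orthant.
\<close>

lemma seeds_determine_values:
  assumes "fold mutate_seed ks (initial_seed B) = fold mutate_seed ls (initial_seed B)"
    and "positive_vec x"
  shows "cluster_map_seq B ks x = cluster_map_seq B ls x"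
proof -
  have "has_values (fst (fold mutate_seed ks (initial_seed B)) $ j) (\<lambda>x. cluster_map_seq B ks x $ j)"
    for ks j
    unfolding initial_seed_def
    by (rule seed_values[where F = "\<lambda>x. x"]) (simp add: has_values_var)
  from has_values_unique[OF this this[of ls, folded assms(1)] assms(2)]
  show ?thesis by (simp add: vec_eq_iff)
qed

lemma exchange_monomial_pos: "positive_vec x \<Longrightarrow> 0 < exchange_monomial s B k x"
  by (auto simp: exchange_monomial_def positive_vec_def intro: prod_pos)

lemma positive_cluster_map: "positive_vec x \<Longrightarrow> positive_vec (cluster_map B k x)"
  using exchange_monomial_pos[of x]
  by (auto simp: positive_vec_def cluster_map_def intro!: mult_pos_pos add_pos_pos)

lemma positive_cluster_map_seq: "positive_vec x \<Longrightarrow> positive_vec (cluster_map_seq B ks x)"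
  by (induction ks arbitrary: B x) (auto intro: positive_cluster_map)

text \<open>
  A mutation of the matrix negates its column \<open>k\<close>, which swaps the two exchange monomials.
\<close>

lemma cluster_map_cluster_map:
  assumes "symmetrizes d B" "positive_vec x"
  shows "cluster_map (mutate k B) k (cluster_map B k x) = x"
proof -
  have "exchange_monomial s (mutate k B) k (cluster_map B k x) = exchange_monomial (- s) B k x" for s
    unfolding exchange_monomial_def
    by (rule prod.cong) (auto simp: mutate_nth cluster_map_def diagonal_zero[OF assms(1)])
  from this[of 1] this[of "-1"]
  have m: "exchange_monomial 1 (mutate k B) k (cluster_map B k x) = exchange_monomial (- 1) B k x"
    "exchange_monomial (- 1) (mutate k B) k (cluster_map B k x) = exchange_monomial 1 B k x"
    by simp_all
  let ?P = "exchange_monomial 1 B k x + exchange_monomial (- 1) B k x"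
  have "0 < ?P" "0 < x $ k"
    using exchange_monomial_pos[OF assms(2)] assms(2) by (auto simp: positive_vec_def intro: add_pos_pos)
  then have "inverse (inverse (x $ k) * ?P) * (exchange_monomial (- 1) B k x + exchange_monomial 1 B k x) = x $ k"
    by (simp add: add.commute)
  moreover have "cluster_map (mutate k B) k y $ k =
      inverse (y $ k) * (exchange_monomial 1 (mutate k B) k y + exchange_monomial (- 1) (mutate k B) k y)" for y
    by (simp add: cluster_map_def)
  moreover have "cluster_map B k x $ k = inverse (x $ k) * ?P"
    by (simp add: cluster_map_def)
  ultimately have "cluster_map (mutate k B) k (cluster_map B k x) $ k = x $ k"
    by (simp only: m)
  moreover have "cluster_map (mutate k B) k (cluster_map B k x) $ j = x $ j" if "j \<noteq> k" for j
    using that by (simp add: cluster_map_def)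
  ultimately have "cluster_map (mutate k B) k (cluster_map B k x) $ j = x $ j" for j
    by metis
  then show ?thesis by (simp add: vec_eq_iff)
qed

lemma cluster_map_seq_rev:
  assumes "symmetrizes d B" "positive_vec x"
  shows "cluster_map_seq (fold mutate ks B) (rev ks) (cluster_map_seq B ks x) = x"
  using assms
proof (induction ks arbitrary: B x)
  case (Cons k ks)
  note B' = symmetrizes_mutate[OF Cons.prems(1), of k]
  show ?case
    using Cons.IH[OF B' positive_cluster_map[OF Cons.prems(2)]] Cons.prems
    by (simp add: cluster_map_seq_append fold_mutate_rev cluster_map_cluster_map)
qed auto

section \<open>Termination of directed mutation in finite type\<close>

text \<open>
  The logarithm at \<open>x\<close> of the cluster monomial with exponents \<open>a $ j / d j\<close>. The weights
  \<open>1 / d j\<close> account for the fact that mutation maps use the rows of the matrix and cluster mutations its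
  columns.
\<close>

definition pairing :: "('n \<Rightarrow> int) \<Rightarrow> real ^ 'n \<Rightarrow> real ^ 'n \<Rightarrow> real" where
  "pairing d a x = (\<Sum>j\<in>UNIV. a $ j * ln (x $ j) / of_int (d j))"

lemma pairing_one [simp]: "pairing d a 1 = 0"
  by (simp add: pairing_def)

text \<open>
  The contribution of the piece \<open>s\<close> is the logarithm of one of the two exchange monomials, whereas the
  exchange relation produces the logarithm of their sum. Since the sum is larger than either summand,
  the pairing moves strictly, in the direction opposite to the sign of \<open>a $ k\<close>.
\<close>

lemma pairing_mutation_piece:
  assumes B: "symmetrizes d B" and x: "positive_vec x"
  shows "pairing d (mutation_piece s B k a) (cluster_map B k x) =
    pairing d a x + a $ k / of_int (d k) * (ln (exchange_monomial (- s) B k x)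
      - ln (exchange_monomial 1 B k x + exchange_monomial (-1) B k x))"
proof -
  let ?P = "exchange_monomial 1 B k x + exchange_monomial (-1) B k x"
  have P: "0 < ?P" using exchange_monomial_pos[OF x] by (auto intro: add_pos_pos)
  have xk: "0 < x $ k" for k using x by (simp add: positive_vec_def)
  then have xk0: "x $ k \<noteq> 0" for k using less_irrefl by metis
  let ?c = "\<lambda>j. a $ k * of_int (max (s * B $ k $ j) 0) * ln (x $ j) / of_int (d j)"
  have lnP: "ln (exchange_monomial (- s) B k x) = (\<Sum>j\<in>UNIV. of_int (max (- s * B $ j $ k) 0) * ln (x $ j))"
    unfolding exchange_monomial_def
    by (subst ln_prod) (use xk xk0 in \<open>simp_all add: ln_realpow\<close>)
  have c: "?c j = a $ k / of_int (d k) * (of_int (max (- s * B $ j $ k) 0) * ln (x $ j))" for j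
  proof -
    note D = symmetrizesD[OF B]
    have "d k * (s * B $ k $ j) = - (d j * (s * B $ j $ k))"
      using arg_cong[OF D(2)[of k j], of "\<lambda>u. s * u"] by (simp add: mult_ac)
    from scaled_pos_part[OF this D(1) D(1)]
    have "real_of_int (d k * max (s * B $ k $ j) 0) = of_int (d j * max (- s * B $ j $ k) 0)"
      by simp
    then have "of_int (max (s * B $ k $ j) 0) / real_of_int (d j) = of_int (max (- s * B $ j $ k) 0) / of_int (d k)"
      using D(1)[of j] D(1)[of k] by (simp add: field_simps)
    then have "a $ k * ln (x $ j) * (of_int (max (s * B $ k $ j) 0) / real_of_int (d j))
      = a $ k * ln (x $ j) * (of_int (max (- s * B $ j $ k) 0) / of_int (d k))" by simp
    then show ?thesis by (simp add: mult_ac)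
  qed
  have "mutation_piece s B k a $ j * ln (cluster_map B k x $ j) / of_int (d j) =
     a $ j * ln (x $ j) / of_int (d j) + ?c j - (if j = k then a $ k / of_int (d k) * ln ?P else 0)" for j
  proof (cases "j = k")
    case True
    have "ln (inverse (x $ k) * ?P) = ln ?P - ln (x $ k)"
      using P xk[of k] by (simp only: ln_mult_pos ln_inverse positive_imp_inverse_positive)
    then have "ln (cluster_map B k x $ k) = ln ?P - ln (x $ k)"
      by (simp only: cluster_map_def vec_lambda_beta if_True simp_thms)
    then show ?thesis
      using True by (simp add: mutation_piece_def diagonal_zero[OF B] diff_divide_distrib right_diff_distrib)
  next
    case False
    then show ?thesis
      by (simp add: mutation_piece_def cluster_map_def add_divide_distrib distrib_right)
  qed
  then have "pairing d (mutation_piece s B k a) (cluster_map B k x) =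
     pairing d a x + (\<Sum>j\<in>UNIV. ?c j) - a $ k / of_int (d k) * ln ?P"
    by (simp add: pairing_def sum.distrib sum_subtractf)
  also have "(\<Sum>j\<in>UNIV. ?c j) = a $ k / of_int (d k) * ln (exchange_monomial (- s) B k x)"
    unfolding lnP sum_distrib_left c ..
  finally show ?thesis by (simp add: algebra_simps)
qed

lemma pairing_mutation_map:
  assumes "symmetrizes d B" "positive_vec x" "\<sigma> * a $ k < 0"
  shows "\<sigma> * pairing d a x < \<sigma> * pairing d (mutation_map B k a) (cluster_map B k x)"
proof -
  define s :: int where "s = (if 0 \<le> a $ k then 1 else -1)"
  let ?P = "exchange_monomial 1 B k x + exchange_monomial (-1) B k x"
  have m: "mutation_map B k a = mutation_piece s B k a"
    by (simp add: s_def mutation_map_nonneg mutation_map_nonpos)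
  have "exchange_monomial (- s) B k x < ?P"
    using exchange_monomial_pos[OF assms(2), of 1 B k] exchange_monomial_pos[OF assms(2), of "-1" B k]
    by (auto simp: s_def)
  then have l: "ln (exchange_monomial (- s) B k x) - ln ?P < 0"
    using exchange_monomial_pos[OF assms(2), of "-s" B k] by simp
  have "\<sigma> * a $ k / of_int (d k) < 0"
    using assms(3) symmetrizesD(1)[OF assms(1), of k] by (simp add: divide_less_0_iff)
  from mult_neg_neg[OF this l] show ?thesis
    unfolding m pairing_mutation_piece[OF assms(1,2)] by (simp add: distrib_left mult_ac)
qed

text \<open>
  A path is directed if every step mutates at a coordinate whose sign is opposite to \<open>\<sigma>\<close>.
\<close>

fun directed :: "real \<Rightarrow> int ^ 'n ^ 'n \<Rightarrow> 'n list \<Rightarrow> real ^ 'n \<Rightarrow> bool" where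
  "directed \<sigma> B [] a \<longleftrightarrow> True"
| "directed \<sigma> B (k # ks) a \<longleftrightarrow> \<sigma> * a $ k < 0 \<and> directed \<sigma> (mutate k B) ks (mutation_map B k a)"

lemma directed_append:
  "directed \<sigma> B (ks @ ls) a \<longleftrightarrow>
     directed \<sigma> B ks a \<and> directed \<sigma> (fold mutate ks B) ls (mutation_map_seq B ks a)"
  by (induction ks arbitrary: B a) auto

lemma pairing_directed:
  assumes "symmetrizes d B" "positive_vec x" "directed \<sigma> B ks a" "ks \<noteq> []"
  shows "\<sigma> * pairing d a x < \<sigma> * pairing d (mutation_map_seq B ks a) (cluster_map_seq B ks x)"
  using assms
proof (induction ks arbitrary: B a x)
  case (Cons k ks)
  from Cons.prems have 1: "\<sigma> * pairing d a x < \<sigma> * pairing d (mutation_map B k a) (cluster_map B k x)"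
    by (auto intro: pairing_mutation_map)
  show ?case
  proof (cases "ks = []")
    case False
    have "\<sigma> * pairing d (mutation_map B k a) (cluster_map B k x) < \<sigma> * pairing d
        (mutation_map_seq (mutate k B) ks (mutation_map B k a))
        (cluster_map_seq (mutate k B) ks (cluster_map B k x))"
      by (rule Cons.IH) (use Cons.prems False in \<open>simp_all add: symmetrizes_mutate positive_cluster_map\<close>)
    then show ?thesis using 1 by simp
  qed (use 1 in auto)
qed auto

definition seeds :: "int ^ 'n ^ 'n \<Rightarrow> ('n :: finite) seed set" where
  "seeds B = {fold mutate_seed ks (initial_seed B) | ks. True}"

text \<open>
  The prefixes of a directed path lead to distinct seeds. For equal seeds one can choose the initial
  point \<open>x\<close> such that both clusters take the value \<open>(1,\<dots>,1)\<close>; then both pairings vanish, although the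
  pairing has strictly moved in between.
\<close>

lemma length_directed_le:
  fixes B :: "int ^ 'n ^ 'n"
  assumes B: "symmetrizes d B" and fin: "finite (seeds B)"
    and dir: "directed \<sigma> (fold mutate us B) ks a"
  shows "length ks \<le> card (seeds B)"
proof -
  let ?f = "\<lambda>i. fold mutate_seed (us @ take i ks) (initial_seed B)"
  have ne: "?f i \<noteq> ?f j" if ij: "i < j" "j \<le> length ks" for i j
  proof
    assume eq: "?f i = ?f j"
    define p where "p = us @ take i ks"
    define q where "q = take (j - i) (drop i ks)"
    define x :: "real ^ 'n" where "x = cluster_map_seq (fold mutate p B) (rev p) 1"
    have tj: "take j ks = take i ks @ q"
      using ij take_add[of i "j - i" ks] by (simp add: q_def)
    have q: "q \<noteq> []" using ij by (simp add: q_def)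
    note Bp = symmetrizes_fold_mutate[OF B, of p]
    have x: "positive_vec x"
      unfolding x_def by (intro positive_cluster_map_seq positive_vec_one)
    have px: "cluster_map_seq B p x = 1"
      using cluster_map_seq_rev[OF Bp positive_vec_one, of "rev p"]
      by (simp add: x_def fold_mutate_rev)
    have "cluster_map_seq B (p @ q) x = cluster_map_seq B p x"
      by (rule seeds_determine_values[OF _ x]) (use eq tj in \<open>simp add: p_def\<close>)
    then have qx: "cluster_map_seq (fold mutate p B) q 1 = 1"
      using px by (simp add: cluster_map_seq_append)
    have "directed \<sigma> (fold mutate us B) (take j ks) a"
      using dir directed_append[of \<sigma> _ "take j ks" "drop j ks"] by simp
    then have "directed \<sigma> (fold mutate p B) q (mutation_map_seq (fold mutate us B) (take i ks) a)"
      by (simp add: tj directed_append p_def)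
    from pairing_directed[OF Bp positive_vec_one this q] show False
      by (simp add: qx)
  qed
  have "inj_on ?f {..length ks}"
  proof (rule inj_onI)
    fix i j assume "i \<in> {..length ks}" "j \<in> {..length ks}" "?f i = ?f j"
    then show "i = j"
      using ne[of i j] ne[of j i] by (cases i j rule: linorder_cases) auto
  qed
  moreover have "?f ` {..length ks} \<subseteq> seeds B"
    unfolding seeds_def by blast
  ultimately have "card {..length ks} \<le> card (seeds B)"
    using fin card_inj_on_le by blast
  then show ?thesis by simp
qed

text \<open>
  Restricting the directions to \<open>J\<close> amounts to freezing the other ones. The prefix \<open>us\<close> is there
  because finiteness is known for the seeds of \<open>B\<close> only, while paths are needed from every chart.
\<close>

lemma directed_terminates:
  assumes "symmetrizes d B" "finite (seeds B)"
  shows "\<exists>ks. set ks \<subseteq> J \<and> directed \<sigma> (fold mutate us B) ks a \<and>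
    (\<forall>j\<in>J. 0 \<le> \<sigma> * mutation_map_seq (fold mutate us B) ks a $ j)"
proof -
  let ?P = "\<lambda>ks. set ks \<subseteq> J \<and> directed \<sigma> (fold mutate us B) ks a"
  have "?P []" by simp
  moreover have "\<forall>ks. ?P ks \<longrightarrow> length ks < Suc (card (seeds B))"
    using length_directed_le[OF assms] by (auto simp: less_Suc_eq_le)
  ultimately obtain ks where ks: "?P ks" and mx: "\<And>ls. ?P ls \<Longrightarrow> length ls \<le> length ks"
    using ex_has_greatest_nat[of ?P "[]" length] by blast
  show ?thesis
  proof (intro exI conjI ballI)
    fix j assume j: "j \<in> J"
    show "0 \<le> \<sigma> * mutation_map_seq (fold mutate us B) ks a $ j"
    proof (rule ccontr)
      assume "\<not> ?thesis"
      then have "?P (ks @ [j])" using ks j by (auto simp: directed_append)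
      from mx[OF this] show False by simp
    qed
  qed (use ks in auto)
qed

text \<open>
  Follow the segment from an interior point of \<open>O\<close> to \<open>x\<close> and cross the walls in the order in which it
  meets them. In coordinates this means choosing, among the negative coordinates of \<open>x\<close>, one that
  minimizes the ratio to the image of \<open>(-1,\<dots>,-1)\<close>. The path is then directed for \<open>x\<close> and for
  \<open>(-1,\<dots>,-1)\<close> simultaneously. The number \<open>\<rho>\<close> encodes how far the segment has been followed.
\<close>

lemma guided_path:
  fixes x :: "real ^ 'n"
  assumes B: "symmetrizes d B" and fin: "finite (seeds B)"
  shows "\<exists>ks. set ks \<subseteq> J \<and> directed 1 (fold mutate us B) ks x \<and> directed 1 (fold mutate us B) ks (- 1) \<and>
    (\<forall>j\<in>J. 0 \<le> mutation_map_seq (fold mutate us B) ks x $ j)"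
proof -
  let ?B = "fold mutate us B"
  let ?F = "\<lambda>ks. mutation_map_seq ?B ks"
  define P where "P = (\<lambda>ks. set ks \<subseteq> J \<and> directed 1 ?B ks x \<and> directed 1 ?B ks (- 1) \<and>
    (\<exists>\<rho>>0. \<forall>j\<in>J. ?F ks (- 1) $ j \<le> \<rho> * ?F ks x $ j))"
  have "P []"
  proof -
    define \<rho> where "\<rho> = 1 / (1 + norm x)"
    have n: "0 < 1 + norm x" using norm_ge_zero[of x] by linarith
    have "- 1 \<le> \<rho> * x $ j" for j
    proof -
      have "- (1 + norm x) \<le> x $ j"
        using component_le_norm_cart[of x j] by linarith
      then show ?thesis using n by (simp add: \<rho>_def field_simps)
    qed
    moreover have "\<rho> > 0" using n by (simp add: \<rho>_def)
    ultimately have "\<exists>\<rho>>0. \<forall>j\<in>J. ?F [] (- 1) $ j \<le> \<rho> * ?F [] x $ j"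
      by (intro exI[of _ \<rho>]) simp
    then show ?thesis by (simp add: P_def)
  qed
  moreover have "\<forall>ks. P ks \<longrightarrow> length ks < Suc (card (seeds B))"
    using length_directed_le[OF assms] by (auto simp: P_def less_Suc_eq_le)
  ultimately obtain ks where ks: "P ks" and mx: "\<And>ls. P ls \<Longrightarrow> length ls \<le> length ks"
    using ex_has_greatest_nat[of P "[]" length] by blast
  define u v where "u = ?F ks x" and "v = ?F ks (- 1)"
  have "0 \<le> u $ j" if j: "j \<in> J" for j
  proof (rule ccontr)
    assume neg: "\<not> 0 \<le> u $ j"
    define N where "N = {m \<in> J. u $ m < 0}"
    have N: "N \<noteq> {}" "finite N" using neg j by (auto simp: N_def)
    \<comment> \<open>the wall that the segment meets next\<close>
    obtain m where m: "m \<in> N" and min: "\<And>i. i \<in> N \<Longrightarrow> v $ m / u $ m \<le> v $ i / u $ i"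
      using ex_is_arg_min_if_finite[OF N(2,1), of "\<lambda>i. v $ i / u $ i"]
      unfolding is_arg_min_linorder by blast
    obtain \<rho> where \<rho>: "\<rho> > 0" "\<And>i. i \<in> J \<Longrightarrow> v $ i \<le> \<rho> * u $ i"
      using ks unfolding P_def u_def v_def by blast
    have um: "u $ m < 0" "m \<in> J" using m by (auto simp: N_def)
    then have vm: "v $ m < 0" using \<rho>(2)[of m] mult_pos_neg[OF \<rho>(1), of "u $ m"] by linarith
    define \<rho>' where "\<rho>' = v $ m / u $ m"
    have "\<rho> \<le> \<rho>'" using \<rho>(2)[OF um(2)] um(1) by (simp add: \<rho>'_def neg_le_divide_eq)
    then have \<rho>'0: "\<rho>' > 0" using \<rho>(1) by linarith
    have inv: "v $ i \<le> \<rho>' * u $ i" if "i \<in> J" for i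
    proof (cases "u $ i < 0")
      case True
      then have "\<rho>' \<le> v $ i / u $ i" using min that by (auto simp: N_def \<rho>'_def)
      then show ?thesis using True by (simp add: neg_le_divide_eq)
    next
      case False
      then have "\<rho> * u $ i \<le> \<rho>' * u $ i" using \<open>\<rho> \<le> \<rho>'\<close> by (intro mult_right_mono) auto
      then show ?thesis using \<rho>(2)[OF that] by linarith
    qed
    let ?B' = "fold mutate ks ?B"
    have "mutation_map ?B' m v $ i \<le> \<rho>' * mutation_map ?B' m u $ i" if "i \<in> J" for i
    proof -
      have vu: "v $ m = \<rho>' * u $ m" using um by (simp add: \<rho>'_def)
      show ?thesis
        using inv[OF that] vm um
        by (simp add: mutation_map_nonpos mutation_piece_def vu algebra_simps)
    qed
    then have "\<exists>\<rho>>0. \<forall>j\<in>J. ?F (ks @ [m]) (- 1) $ j \<le> \<rho> * ?F (ks @ [m]) x $ j"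
      using \<rho>'0 unfolding mutation_map_seq_snoc u_def v_def by blast
    moreover have "set (ks @ [m]) \<subseteq> J" using ks um by (simp add: P_def)
    moreover have "directed 1 ?B (ks @ [m]) x" "directed 1 ?B (ks @ [m]) (- 1)"
      using ks um vm by (simp_all add: P_def directed_append u_def v_def)
    ultimately have "P (ks @ [m])" by (simp add: P_def)
    from mx[OF this] show False by simp
  qed
  then show ?thesis using ks unfolding P_def u_def by blast
qed

section \<open>Sign coherence and linearity on orthants\<close>

definition same_sign_on :: "'a set \<Rightarrow> ('a \<Rightarrow> real) \<Rightarrow> bool" where
  "same_sign_on K f \<longleftrightarrow> (\<forall>a\<in>K. 0 \<le> f a) \<or> (\<forall>a\<in>K. f a \<le> 0)"

text \<open>
  What the Standard Hypotheses are used for, in a form that is inherited by all mutated matrices.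
  The symmetrizer \<open>d\<close> is included because it is common to all of them.
\<close>

definition sign_coherent :: "('n \<Rightarrow> int) \<Rightarrow> int ^ 'n ^ 'n \<Rightarrow> bool" where
  "sign_coherent d B \<longleftrightarrow> symmetrizes d B \<and>
     (\<forall>us ks j. same_sign_on nonneg_orthant (\<lambda>a. mutation_map_seq (fold mutate us B) ks a $ j) \<and>
       same_sign_on (uminus ` nonneg_orthant) (\<lambda>a. mutation_map_seq (fold mutate us B) ks a $ j))"

lemma sign_coherent_symmetrizes: "sign_coherent d B \<Longrightarrow> symmetrizes d B"
  by (simp add: sign_coherent_def)

lemma sign_coherent_fold_mutate: "sign_coherent d B \<Longrightarrow> sign_coherent d (fold mutate us B)"
  unfolding sign_coherent_def using symmetrizes_fold_mutate fold_append
  by (metis comp_apply)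

lemma sign_coherent_mutate: "sign_coherent d B \<Longrightarrow> sign_coherent d (mutate k B)"
  using sign_coherent_fold_mutate[of d B "[k]"] by simp

lemma sign_coherentD:
  assumes "sign_coherent d B"
  shows "same_sign_on nonneg_orthant (\<lambda>a. mutation_map_seq B ks a $ j)"
    "same_sign_on (uminus ` nonneg_orthant) (\<lambda>a. mutation_map_seq B ks a $ j)"
  using assms unfolding sign_coherent_def by (metis fold_simps(1))+

text \<open>
  Signs are constant on a class by definition, and weak signs survive passage to the closure by
  continuity of mutation maps.
\<close>

lemma B_cone_same_sign:
  assumes "K \<in> B_cones B"
  shows "same_sign_on K (\<lambda>a. mutation_map_seq B ks a $ j)"
proof -
  obtain a where K: "K = closure (B_equiv B `` {a})"
    using assms by (auto simp: B_cones_def elim: quotientE)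
  let ?f = "\<lambda>b. mutation_map_seq B ks b $ j"
  have sg: "sgn (?f b) = sgn (?f a)" if "b \<in> B_equiv B `` {a}" for b
    using that by (auto simp: B_equiv_def sgn_vec_def vec_eq_iff)
  have cont: "continuous_on UNIV ?f"
    by (intro continuous_intros continuous_on_mutation_map_seq)
  have "closed {b. 0 \<le> ?f b}" "closed {b. ?f b \<le> 0}"
    using cont by (auto intro!: closed_Collect_le)
  moreover have "B_equiv B `` {a} \<subseteq> {b. 0 \<le> ?f b} \<or> B_equiv B `` {a} \<subseteq> {b. ?f b \<le> 0}"
    using sg by (smt (verit, best) mem_Collect_eq sgn_less sgn_greater subsetI)
  ultimately show ?thesis
    unfolding K same_sign_on_def using closure_minimal by blast
qed

lemma standard_hypotheses_sign_coherent:
  assumes "symmetrizes d B" "standard_hypotheses B"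
  shows "sign_coherent d B"
  using assms B_cone_same_sign
  unfolding sign_coherent_def standard_hypotheses_def mutation_class_def by blast

text \<open>
  Where all coordinates keep a weak sign, each mutation acts through a single linear piece.
\<close>

lemma mutation_map_seq_add:
  assumes sign: "\<And>ks j. same_sign_on K (\<lambda>a. mutation_map_seq B ks a $ j)"
    and K: "a \<in> K" "b \<in> K" "a + b \<in> K"
  shows "mutation_map_seq B ks (a + b) = mutation_map_seq B ks a + mutation_map_seq B ks b"
proof (induction ks rule: rev_induct)
  case (snoc k ks)
  let ?B = "fold mutate ks B"
  obtain s where s: "mutation_map ?B k (mutation_map_seq B ks c) = mutation_piece s ?B k (mutation_map_seq B ks c)"
    if "c \<in> K" for c
    using sign[of ks k] mutation_map_nonneg mutation_map_nonpos unfolding same_sign_on_def by metis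
  show ?case
    unfolding mutation_map_seq_snoc s[OF K(1)] s[OF K(2)] s[OF K(3)]
    by (simp add: snoc.IH linear_add[OF linear_mutation_piece])
qed auto

lemma mutation_map_seq_sum:
  assumes sign: "\<And>ks j. same_sign_on K (\<lambda>a. mutation_map_seq B ks a $ j)"
    and "0 \<in> K" and add: "\<And>a b. a \<in> K \<Longrightarrow> b \<in> K \<Longrightarrow> a + b \<in> K"
    and scale: "\<And>c a. 0 \<le> c \<Longrightarrow> a \<in> K \<Longrightarrow> c *\<^sub>R a \<in> K"
    and "\<And>i. i \<in> A \<Longrightarrow> 0 \<le> c i" "\<And>i. i \<in> A \<Longrightarrow> v i \<in> K"
  shows "mutation_map_seq B ks (\<Sum>i\<in>A. c i *\<^sub>R v i) = (\<Sum>i\<in>A. c i *\<^sub>R mutation_map_seq B ks (v i))"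
proof -
  have "(\<Sum>i\<in>A. c i *\<^sub>R v i) \<in> K \<and>
    mutation_map_seq B ks (\<Sum>i\<in>A. c i *\<^sub>R v i) = (\<Sum>i\<in>A. c i *\<^sub>R mutation_map_seq B ks (v i))"
    using assms(5,6)
  proof (induction A rule: infinite_finite_induct)
    case (insert i A)
    have "c i *\<^sub>R v i \<in> K" using insert.prems scale by simp
    with insert show ?case
      by (simp add: add mutation_map_seq_add[OF sign] mutation_map_seq_scaleR)
  qed (use \<open>0 \<in> K\<close> in simp_all)
  then show ?thesis ..
qed

lemma axis_in_orthant: "axis i 1 \<in> nonneg_orthant"
  by (simp add: nonneg_orthant_def axis_def)

lemma sum_axis: "(\<Sum>i\<in>UNIV. x $ i *\<^sub>R axis i 1) = (x :: real ^ 'n)"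
  by (simp add: vec_eq_iff axis_def if_distrib cong: if_cong)

lemma mutation_map_seq_orthant:
  assumes "sign_coherent d B" "a \<in> nonneg_orthant"
  shows "mutation_map_seq B ks a = (\<Sum>i\<in>UNIV. a $ i *\<^sub>R mutation_map_seq B ks (axis i 1))"
proof -
  have "mutation_map_seq B ks (\<Sum>i\<in>UNIV. a $ i *\<^sub>R axis i 1)
      = (\<Sum>i\<in>UNIV. a $ i *\<^sub>R mutation_map_seq B ks (axis i 1))"
    by (rule mutation_map_seq_sum[where K = nonneg_orthant, OF sign_coherentD(1)[OF assms(1)] _ _ _ _ axis_in_orthant])
      (use assms(2) in \<open>auto simp: nonneg_orthant_def\<close>)
  then show ?thesis by (simp only: sum_axis)
qed

section \<open>The linear map on the negative orthant and the cone of a chart\<close>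

text \<open>
  The linear map that agrees with the mutation map of \<open>ks\<close> on the negative orthant.
\<close>

definition linear_extension :: "int ^ 'n ^ 'n \<Rightarrow> 'n list \<Rightarrow> real ^ 'n \<Rightarrow> real ^ 'n" where
  "linear_extension B ks x = (\<Sum>i\<in>UNIV. x $ i *\<^sub>R (- mutation_map_seq B ks (- axis i 1)))"

lemma linear_linear_extension: "linear (linear_extension B ks)"
  by (rule linearI)
     (simp_all only: linear_extension_def vector_add_component vector_scaleR_component scaleR_left_distrib
       sum.distrib scaleR_sum_right scaleR_scaleR real_scaleR_def)

lemma linear_extension_axis [simp]: "linear_extension B ks (axis i 1) = - mutation_map_seq B ks (- axis i 1)"
proof -
  have "linear_extension B ks (axis i 1) = (\<Sum>j\<in>UNIV. if j = i then - mutation_map_seq B ks (- axis j 1) else 0)"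
    unfolding linear_extension_def by (rule sum.cong) (auto simp: axis_def)
  then show ?thesis by simp
qed

lemma linear_extension_Nil [simp]: "linear_extension B [] x = x"
  by (simp add: linear_extension_def sum_axis)

lemma linear_extension_nth: "linear_extension B ks x $ k = (\<Sum>i\<in>UNIV. x $ i * linear_extension B ks (axis i 1) $ k)"
  unfolding linear_extension_axis by (simp add: linear_extension_def)

text \<open>
  The coordinate \<open>k\<close> of the linear extension, as a covector. It turns out to be the inner normal of the
  wall of the cone of \<open>ks\<close> that is opposite to its ray \<open>k\<close>, and a rescaled c-vector of the transposed
  matrix.
\<close>

definition normal :: "int ^ 'n ^ 'n \<Rightarrow> 'n list \<Rightarrow> 'n \<Rightarrow> 'n \<Rightarrow> real" where
  "normal B ks k i = linear_extension B ks (axis i 1) $ k"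

lemma linear_extension_nth_normal: "linear_extension B ks x $ k = (\<Sum>i\<in>UNIV. x $ i * normal B ks k i)"
  unfolding normal_def by (rule linear_extension_nth)

lemma normal_sign:
  assumes "sign_coherent d B"
  shows "(\<forall>i. 0 \<le> normal B ks k i) \<or> (\<forall>i. normal B ks k i \<le> 0)"
proof -
  have i: "- axis i 1 \<in> uminus ` nonneg_orthant" for i :: 'a
    using axis_in_orthant by blast
  consider "\<forall>a\<in>uminus ` nonneg_orthant. 0 \<le> mutation_map_seq B ks a $ k"
    | "\<forall>a\<in>uminus ` nonneg_orthant. mutation_map_seq B ks a $ k \<le> 0"
    using sign_coherentD(2)[OF assms, of ks k] unfolding same_sign_on_def by blast
  then show ?thesis
    using i by cases (simp_all add: normal_def axis_in_orthant)
qed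

lemma normal_Ints: "symmetrizes d B \<Longrightarrow> normal B ks k i \<in> \<int>"
  unfolding normal_def linear_extension_axis vector_uminus_component
  by (rule Ints_minus, rule mutation_map_seq_Ints) (auto simp: axis_def)

text \<open>
  The last mutation acts on the image of \<open>-O\<close>, where its coordinate \<open>k\<close> has the sign opposite to
  that of the normal.
\<close>

lemma linear_extension_snoc:
  assumes "(s = -1 \<and> (\<forall>i. 0 \<le> normal B ks k i)) \<or> (s = 1 \<and> (\<forall>i. normal B ks k i \<le> 0))"
  shows "linear_extension B (ks @ [k]) x = mutation_piece s (fold mutate ks B) k (linear_extension B ks x)"
proof -
  have "mutation_map_seq B (ks @ [k]) (- axis i 1)
      = mutation_piece s (fold mutate ks B) k (mutation_map_seq B ks (- axis i 1))" for i
    using assms unfolding mutation_map_seq_snoc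
    by (auto simp: normal_def mutation_map_nonneg mutation_map_nonpos)
  then show ?thesis
    using linear_mutation_piece[of s "fold mutate ks B" k]
    by (simp add: linear_extension_def linear_sum linear_scale linear_neg)
qed

text \<open>
  Mutation-invariance of the skew form \<open>D B\<close> on covectors, with \<open>D\<close> the diagonal matrix of \<open>d\<close>: if
  \<open>P\<close> is the matrix of the linear extension acting on row vectors, then
  \<open>D B' = P\<^sup>T D B P\<close> for the mutated matrix \<open>B'\<close>. This is row \<open>j\<close> of that identity.
\<close>

lemma linear_extension_rows:
  assumes B: "sign_coherent d B"
  shows "linear_extension B ks (\<Sum>i\<in>UNIV. (normal B ks j i * of_int (d i)) *\<^sub>R real_vec (B $ i))
    = of_int (d j) *\<^sub>R real_vec (fold mutate ks B $ j)"
proof (induction ks arbitrary: j rule: rev_induct)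
  case Nil
  have "(\<Sum>i\<in>UNIV. (normal B [] j i * of_int (d i)) *\<^sub>R real_vec (B $ i))
      = (\<Sum>i\<in>UNIV. if i = j then of_int (d i) *\<^sub>R real_vec (B $ i) else 0)"
    by (rule sum.cong) (auto simp: normal_def axis_def simp del: linear_extension_axis)
  then show ?case by simp
next
  case (snoc k ks)
  let ?B = "fold mutate ks B"
  let ?\<beta> = "\<lambda>ks j. (\<Sum>i\<in>UNIV. (normal B ks j i * of_int (d i)) *\<^sub>R real_vec (B $ i))"
  obtain s :: int where s: "(s = -1 \<and> (\<forall>i. 0 \<le> normal B ks k i)) \<or> (s = 1 \<and> (\<forall>i. normal B ks k i \<le> 0))"
    using normal_sign[OF B, of ks k] by metis
  note D = symmetrizesD[OF symmetrizes_fold_mutate[OF sign_coherent_symmetrizes[OF B], of ks]]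
  have kk: "?B $ k $ k = 0"
    using diagonal_zero[OF symmetrizes_fold_mutate[OF sign_coherent_symmetrizes[OF B]]] .
  have n: "normal B (ks @ [k]) j i = (if j = k then - normal B ks k i
      else normal B ks j i + normal B ks k i * of_int (max (s * ?B $ k $ j) 0))" for i
    unfolding normal_def linear_extension_snoc[OF s] by (simp add: mutation_piece_def)
  show ?case
  proof (cases "j = k")
    case True
    have "?\<beta> (ks @ [k]) j = - ?\<beta> ks k"
      unfolding n using True by (simp add: sum_negf)
    then have "linear_extension B (ks @ [k]) (?\<beta> (ks @ [k]) j)
        = mutation_piece s ?B k (- (of_int (d k) *\<^sub>R real_vec (?B $ k)))"
      by (simp only: linear_extension_snoc[OF s] linear_neg[OF linear_linear_extension] linear_neg[OF linear_mutation_piece] snoc)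
    then show ?thesis
      using True kk by (auto simp: vec_eq_iff mutation_piece_def real_vec_def mutate_nth)
  next
    case False
    let ?m = "real_of_int (max (s * ?B $ k $ j) 0)"
    have "?\<beta> (ks @ [k]) j = ?\<beta> ks j + ?m *\<^sub>R ?\<beta> ks k"
      unfolding n using False
      by (simp add: sum.distrib[symmetric] scaleR_sum_right algebra_simps)
    then have "linear_extension B (ks @ [k]) (?\<beta> (ks @ [k]) j)
        = mutation_piece s ?B k (of_int (d j) *\<^sub>R real_vec (?B $ j) + ?m *\<^sub>R (of_int (d k) *\<^sub>R real_vec (?B $ k)))"
      by (simp only: linear_extension_snoc[OF s] linear_add[OF linear_linear_extension] linear_scale[OF linear_linear_extension] snoc
          linear_add[OF linear_mutation_piece] linear_scale[OF linear_mutation_piece])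
    also have "\<dots> = of_int (d j) *\<^sub>R real_vec (mutate k ?B $ j)"
    proof -
      have "d k * (s * ?B $ k $ j) = - (d j * (s * ?B $ j $ k))"
        using arg_cong[OF D(2)[of k j], of "\<lambda>u. s * u"] by (simp add: mult_ac)
      from scaled_pos_part[OF this D(1) D(1)]
      have e: "d k * max (s * ?B $ k $ j) 0 = d j * max (- s * ?B $ j $ k) 0" by simp
      have "mutation_piece s ?B k (of_int (d j) *\<^sub>R real_vec (?B $ j) + ?m *\<^sub>R (of_int (d k) *\<^sub>R real_vec (?B $ k))) $ i
          = of_int (d j * mutate k ?B $ j $ i)" for i
      proof (cases "i = k")
        case True
        then show ?thesis using False kk by (simp add: mutation_piece_def real_vec_def mutate_nth)
      next
        case i: False
        have "sgn (?B $ k $ i) * max (?B $ j $ k * ?B $ k $ i) 0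
            = ?B $ j $ k * max (s * ?B $ k $ i) 0 + max (- s * ?B $ j $ k) 0 * ?B $ k $ i"
          by (rule mutation_term) (use s in auto)
        then have "d j * mutate k ?B $ j $ i = d j * ?B $ j $ i + (d k * max (s * ?B $ k $ j) 0) * ?B $ k $ i
            + (d j * ?B $ j $ k) * max (s * ?B $ k $ i) 0"
          using i False unfolding e by (simp add: mutate_nth algebra_simps)
        then have "real_of_int (d j * mutate k ?B $ j $ i) =
            of_int (d j * ?B $ j $ i + (d k * max (s * ?B $ k $ j) 0) * ?B $ k $ i
            + (d j * ?B $ j $ k) * max (s * ?B $ k $ i) 0)" by simp
        then show ?thesis
          using i kk by (simp add: mutation_piece_def real_vec_def mult_ac del: of_int_max)
      qed
      then show ?thesis by (simp add: vec_eq_iff real_vec_def)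
    qed
    finally show ?thesis by simp
  qed
qed

text \<open>
  The preimage of a unit vector under the mutation map of \<open>ks\<close>, whose inverse is the mutation map of the
  reversed path.
\<close>

definition chart_ray :: "int ^ 'n ^ 'n \<Rightarrow> 'n list \<Rightarrow> 'n \<Rightarrow> real ^ 'n" where
  "chart_ray B ks l = mutation_map_seq (fold mutate ks B) (rev ks) (axis l 1)"

lemma chart_ray_Nil [simp]: "chart_ray B [] l = axis l 1"
  by (simp add: chart_ray_def)

lemma mutation_map_seq_chart_ray:
  "mutation_map_seq B ks (chart_ray B ks l) = axis l 1"
  unfolding chart_ray_def by (rule mutation_map_seq_rev')

lemma chart_ray_append:
  "mutation_map_seq B us (chart_ray B (us @ ks) l) = chart_ray (fold mutate us B) ks l"
proof -
  have "mutation_map_seq (fold mutate us B) ks (mutation_map_seq B us (chart_ray B (us @ ks) l)) = axis l 1"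
    using mutation_map_seq_chart_ray[where B = B and ks = "us @ ks" and l = l]
    by (simp add: mutation_map_seq_append)
  moreover have "mutation_map_seq (fold mutate us B) ks (chart_ray (fold mutate us B) ks l) = axis l 1"
    by (rule mutation_map_seq_chart_ray)
  ultimately show ?thesis
    using mutation_map_seq_eq_iff by metis
qed

lemma chart_ray_Cons: "chart_ray (mutate m B) ks l = mutation_map B m (chart_ray B (m # ks) l)"
  using chart_ray_append[where us = "[m]" and B = B and ks = ks and l = l] by simp

lemma chart_ray_snoc_other: "l \<noteq> k \<Longrightarrow> chart_ray B (ks @ [k]) l = chart_ray B ks l"
  by (simp add: chart_ray_def mutation_map_axis mutate_mutate)

lemma chart_ray_same_sign:
  assumes "sign_coherent d B"
  shows "(\<forall>l. 0 \<le> chart_ray B ks l $ m) \<or> (\<forall>l. chart_ray B ks l $ m \<le> 0)"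
  using sign_coherentD(1)[OF sign_coherent_fold_mutate[OF assms, of ks], of "rev ks" m] axis_in_orthant
  by (auto simp: same_sign_on_def chart_ray_def)

lemma chart_ray_Ints: "symmetrizes d B \<Longrightarrow> chart_ray B ks l $ m \<in> \<int>"
  unfolding chart_ray_def
  by (rule mutation_map_seq_Ints[OF symmetrizes_fold_mutate]) (auto simp: axis_def)

text \<open>
  The rays are integral also for the lattice of vectors whose coordinates \<open>i\<close> are divisible by \<open>d i\<close>.
\<close>

lemma chart_ray_scaled_Ints:
  assumes "symmetrizes d B"
  shows "of_int (d l) * chart_ray B ks l $ m / of_int (d m) \<in> \<int>"
proof -
  have "mutation_map_seq (fold mutate ks B) (rev ks) (of_int (d l) *\<^sub>R axis l 1) $ m / of_int (d m) \<in> \<int>"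
    by (rule mutation_map_seq_scaled_Ints[OF symmetrizes_fold_mutate[OF assms]])
       (auto simp: axis_def)
  then show ?thesis
    using symmetrizesD(1)[OF assms, of l] by (simp add: mutation_map_seq_scaleR chart_ray_def)
qed

lemma normal_scaled_Ints:
  assumes "symmetrizes d B"
  shows "of_int (d i) * normal B ks k i / of_int (d k) \<in> \<int>"
proof -
  have "mutation_map_seq B ks (of_int (d i) *\<^sub>R (- axis i 1)) $ k / of_int (d k) \<in> \<int>"
    by (rule mutation_map_seq_scaled_Ints[OF assms]) (auto simp: axis_def)
  then have "of_int (d i) * mutation_map_seq B ks (- axis i 1) $ k / of_int (d k) \<in> \<int>"
    using symmetrizesD(1)[OF assms, of i] mutation_map_seq_scaleR[of "of_int (d i)" B ks "- axis i 1"]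
    by simp
  from Ints_minus[OF this] show ?thesis
    by (simp add: normal_def)
qed

text \<open>
  Across the wall \<open>x\<^sub>k = 0\<close> of the orthant lies the cone of the mutation in direction \<open>k\<close>; this is
  its one ray that the orthant does not share, in the coordinates of the orthant.
\<close>

definition opposite_ray :: "int ^ 'n ^ 'n \<Rightarrow> 'n \<Rightarrow> real ^ 'n" where
  "opposite_ray B k = (\<chi> j. if j = k then -1 else of_int (max (- (B $ k $ j)) 0))"

lemma mutation_map_chart_ray_snoc:
  "mutation_map_seq B ks (chart_ray B (ks @ [k]) k) = opposite_ray (fold mutate ks B) k"
proof -
  have "chart_ray (fold mutate ks B) [k] k = opposite_ray (fold mutate ks B) k"
    unfolding chart_ray_def fold_simps rev.simps append_Nil mutation_map_seq.simps
      mutate_mutate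
    by (simp add: opposite_ray_def vec_eq_iff mutation_map_nth mutate_nth axis_def)
  then show ?thesis
    using chart_ray_append[where us = ks and B = B and ks = "[k]" and l = k] by simp
qed

text \<open>
  On the cone of \<open>ks\<close> the mutation map sends the rays to the unit vectors by definition. So this says
  that on this cone and on \<open>-O\<close> the mutation map is given by one and the same linear map; equivalently,
  the normals form the basis dual to the rays.
\<close>

definition dual_basis :: "int ^ 'n ^ 'n \<Rightarrow> 'n list \<Rightarrow> bool" where
  "dual_basis B ks \<longleftrightarrow> (\<forall>l. linear_extension B ks (chart_ray B ks l) = axis l 1)"

lemma dual_basis_expansion:
  assumes "dual_basis B ks"
  shows "x = (\<Sum>l\<in>UNIV. linear_extension B ks x $ l *\<^sub>R chart_ray B ks l)"
proof -
  let ?G = "\<lambda>y. \<Sum>l\<in>UNIV. y $ l *\<^sub>R chart_ray B ks l"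
  have G: "linear ?G"
    by (rule linearI) (auto simp: scaleR_left_distrib sum.distrib scaleR_sum_right)
  have "linear_extension B ks (?G y) = y" for y
    using assms
    by (simp add: dual_basis_def linear_sum[OF linear_linear_extension] linear_scale[OF linear_linear_extension] sum_axis del: linear_extension_axis)
  then have "linear_extension B ks \<circ> ?G = id" by (simp add: fun_eq_iff)
  then have "?G \<circ> linear_extension B ks = id"
    by (rule iffD1[OF linear_inverse_left[OF linear_linear_extension G]])
  then show ?thesis unfolding fun_eq_iff by simp
qed

lemma linear_extension_inj:
  assumes "dual_basis B ks" "linear_extension B ks x = linear_extension B ks y"
  shows "x = y"
  using dual_basis_expansion[OF assms(1)] assms(2) by metis

section \<open>Crossing a wall of a cone\<close>

text \<open>
  If the first mutation acts on a whole cone through a single piece, then the linear extensions at its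
  two ends differ by that piece, because a linear map is determined by its values on the rays.
\<close>

lemma linear_extension_mutation_piece:
  assumes D: "dual_basis B (m # ks)" "dual_basis (mutate m B) ks"
    and s: "\<And>l. mutation_map B m (chart_ray B (m # ks) l) = mutation_piece s B m (chart_ray B (m # ks) l)"
  shows "linear_extension B (m # ks) x = linear_extension (mutate m B) ks (mutation_piece s B m x)"
proof -
  note L = linear_mutation_piece[of s B m] linear_linear_extension[of "mutate m B" ks]
  have "linear_extension (mutate m B) ks (mutation_piece s B m x)
      = linear_extension (mutate m B) ks (mutation_piece s B m (\<Sum>l\<in>UNIV. linear_extension B (m # ks) x $ l *\<^sub>R chart_ray B (m # ks) l))"
    by (simp only: dual_basis_expansion[OF D(1), of x, symmetric])
  also have "\<dots> = (\<Sum>l\<in>UNIV. linear_extension B (m # ks) x $ l *\<^sub>R axis l 1)"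
    using D(2) by (simp only: linear_sum[OF L(1)] linear_sum[OF L(2)] linear_scale[OF L(1)]
      linear_scale[OF L(2)] s[symmetric] chart_ray_Cons[symmetric] dual_basis_def)
  finally show ?thesis by (simp only: sum_axis)
qed

lemma opposite_ray_self [simp]: "opposite_ray B k $ k = -1"
  by (simp add: opposite_ray_def)

lemma dvd_of_ratio_Ints:
  fixes p q :: int
  assumes "real_of_int p / of_int q \<in> \<int>" "0 < q"
  shows "q dvd p"
proof -
  obtain z where "real_of_int p / of_int q = of_int z"
    using assms(1) by (elim Ints_cases)
  then have "real_of_int p = of_int (z * q)"
    using assms(2) by (simp add: field_simps)
  then have "p = z * q" by (simp only: of_int_eq_iff)
  then show ?thesis by simp
qed

text \<open>
  Behind the wall of the cone of \<open>ks\<close> that is opposite to its ray \<open>k\<close>, the mutation map either still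
  agrees with the linear extension, or differs from it by the row \<open>k\<close> of the mutated matrix. The sign
  of the normal decides which.

  The induction adds a mutation \<open>m\<close> at the start of the path. Unless the wall lies in the hyperplane
  \<open>x\<^sub>m = 0\<close>, the cones on its two sides lie on the same side of this hyperplane, so the new mutation
  creates no bend between them; nor does the normal change sign, as it changes in entry \<open>m\<close> only and
  has another nonzero entry. If the wall does lie in this hyperplane, then the normal is plus or minus the
  unit covector of \<open>m\<close> and is negated. The new mutation bends by a multiple of row \<open>m\<close>, which the
  invariance of the skew form identifies with the row \<open>k\<close> at the end of the path; this bend
  either creates the expected difference or cancels the one that was there.
\<close>

lemma wall_crossing:
  assumes dual: "\<And>B us. sign_coherent d B \<Longrightarrow> length us \<le> length ks \<Longrightarrow> dual_basis B us"
    and B: "sign_coherent d B"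
  shows "((\<forall>i. 0 \<le> normal B ks k i) \<longrightarrow>
      linear_extension B ks (chart_ray B (ks @ [k]) k) = opposite_ray (fold mutate ks B) k) \<and>
    ((\<forall>i. normal B ks k i \<le> 0) \<longrightarrow>
      linear_extension B ks (chart_ray B (ks @ [k]) k)
        = opposite_ray (fold mutate ks B) k + real_vec (fold mutate ks B $ k))"
  using assms
proof (induction ks arbitrary: B)
  case Nil
  have "mutation_map_seq B [] (chart_ray B ([] @ [k]) k) = opposite_ray B k"
    using mutation_map_chart_ray_snoc[where B = B and ks = "[]" and k = k] by simp
  then have "chart_ray B ([] @ [k]) k = opposite_ray B k" by simp
  moreover have "normal B [] k k = 1" by (simp add: normal_def)
  ultimately show ?case by (metis linear_extension_Nil fold_simps(1) not_one_le_zero)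
next
  case (Cons m ks)
  note B = Cons.prems(2)
  note symB = sign_coherent_symmetrizes[OF B]
  define B1 where "B1 = mutate m B"
  have B1: "sign_coherent d B1" unfolding B1_def by (rule sign_coherent_mutate[OF B])
  note symB1 = sign_coherent_symmetrizes[OF B1]
  define Bt where "Bt = fold mutate ks B1"
  have Bt: "fold mutate (m # ks) B = Bt" by (simp add: Bt_def B1_def)
  have kk: "real_vec (Bt $ k) $ k = 0"
    using diagonal_zero[OF symmetrizes_fold_mutate[OF symB1]] by (simp add: Bt_def real_vec_def)
  have D: "dual_basis B (m # ks)" by (rule Cons.prems(1)[OF B]) simp
  have D1: "dual_basis B1 ks" by (rule Cons.prems(1)[OF B1]) simp
  define L where "L = linear_extension B (m # ks)"
  define L1 where "L1 = linear_extension B1 ks"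
  have linL1: "linear L1" unfolding L1_def by (rule linear_linear_extension)
  define g where "g = chart_ray B (m # ks)"
  define g1 where "g1 = chart_ray B1 ks"
  have g1: "g1 l = mutation_map B m (g l)" for l
    unfolding g_def g1_def B1_def by (rule chart_ray_Cons)
  define h where "h = chart_ray B (m # ks @ [k]) k"
  define h1 where "h1 = chart_ray B1 (ks @ [k]) k"
  have h1: "h1 = mutation_map B m h"
    unfolding h_def h1_def B1_def by (rule chart_ray_Cons)
  define w where "w = opposite_ray Bt k"
  have wk: "w $ k = -1" by (simp add: w_def)
  define \<nu> where "\<nu> = normal B (m # ks) k"
  define \<nu>1 where "\<nu>1 = normal B1 ks k"
  have Lk: "L x $ k = (\<Sum>i\<in>UNIV. x $ i * \<nu> i)" for x
    unfolding L_def \<nu>_def by (rule linear_extension_nth_normal)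
  have L1k: "L1 x $ k = (\<Sum>i\<in>UNIV. x $ i * \<nu>1 i)" for x
    unfolding L1_def \<nu>1_def by (rule linear_extension_nth_normal)
  have \<nu>L: "\<nu> i = L (axis i 1) $ k" and \<nu>1L: "\<nu>1 i = L1 (axis i 1) $ k" for i
    by (simp_all only: \<nu>_def \<nu>1_def normal_def L_def L1_def)
  have Lg: "L (g l) = axis l 1" for l
    using D by (simp only: dual_basis_def L_def g_def)
  have L1g: "L1 (g1 l) = axis l 1" for l
    using D1 by (simp only: dual_basis_def L1_def g1_def)
  have \<nu>sign: "(\<forall>i. 0 \<le> \<nu> i) \<or> (\<forall>i. \<nu> i \<le> 0)" "(\<forall>i. 0 \<le> \<nu>1 i) \<or> (\<forall>i. \<nu>1 i \<le> 0)"
    unfolding \<nu>_def \<nu>1_def by (rule normal_sign[OF B], rule normal_sign[OF B1])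
  have IH: "((\<forall>i. 0 \<le> \<nu>1 i) \<longrightarrow> L1 h1 = w) \<and> ((\<forall>i. \<nu>1 i \<le> 0) \<longrightarrow> L1 h1 = w + real_vec (Bt $ k))"
    unfolding \<nu>1_def L1_def h1_def w_def Bt_def
    by (rule Cons.IH[OF _ B1]) (use Cons.prems(1) in simp)
  have gsign: "(\<forall>l. 0 \<le> g l $ m) \<or> (\<forall>l. g l $ m \<le> 0)"
    unfolding g_def by (rule chart_ray_same_sign[OF B])
  have piece: "L x = L1 (mutation_piece s B m x)"
    if "(s = 1 \<and> (\<forall>l. 0 \<le> g l $ m)) \<or> (s = -1 \<and> (\<forall>l. g l $ m \<le> 0))" for s x
    unfolding L_def L1_def B1_def
    by (rule linear_extension_mutation_piece[OF D D1[unfolded B1_def]])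
       (use that in \<open>auto simp: g_def mutation_map_nonneg mutation_map_nonpos\<close>)
  have goal: "((\<forall>i. 0 \<le> \<nu> i) \<longrightarrow> L h = w) \<and> ((\<forall>i. \<nu> i \<le> 0) \<longrightarrow> L h = w + real_vec (Bt $ k))"
  proof (cases "\<exists>j. j \<noteq> k \<and> g j $ m \<noteq> 0")
    case True
    then obtain j where j: "j \<noteq> k" "g j $ m \<noteq> 0" by blast
    \<comment> \<open>The cones on the two sides share \<open>g j\<close>, which is off the hyperplane \<open>x\<^sub>m = 0\<close>.\<close>
    have hg: "(\<forall>l. l \<noteq> k \<longrightarrow> 0 \<le> g l $ m) \<and> 0 \<le> h $ m \<or> (\<forall>l. l \<noteq> k \<longrightarrow> g l $ m \<le> 0) \<and> h $ m \<le> 0"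
      using chart_ray_same_sign[OF B, of "m # ks @ [k]" m]
        chart_ray_snoc_other[where k = k and B = B and ks = "m # ks"]
      unfolding h_def g_def by (metis append_Cons)
    obtain s :: int where s: "(s = 1 \<and> (\<forall>l. 0 \<le> g l $ m)) \<or> (s = -1 \<and> (\<forall>l. g l $ m \<le> 0))"
      using gsign by metis
    then have "(s = 1 \<and> 0 \<le> h $ m) \<or> (s = -1 \<and> h $ m \<le> 0)"
      using hg j by (metis order_antisym)
    then have h1s: "h1 = mutation_piece s B m h"
      unfolding h1 by (auto simp: mutation_map_nonneg mutation_map_nonpos)
    have Lh: "L h = L1 h1" unfolding h1s by (rule piece[OF s])
    have eq: "\<nu> i = \<nu>1 i" if "i \<noteq> m" for i
    proof -
      have "mutation_piece s B m (axis i 1) = axis i 1"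
        using that by (simp add: vec_eq_iff mutation_piece_def axis_def)
      then show ?thesis unfolding \<nu>L \<nu>1L piece[OF s] by simp
    qed
    have "\<exists>i. i \<noteq> m \<and> \<nu> i \<noteq> 0"
    proof (rule ccontr)
      assume "\<not> ?thesis"
      then have "L x $ k = x $ m * \<nu> m" for x
        unfolding Lk by (subst sum.remove[of _ m]) (auto intro!: sum.neutral)
      then have "axis j 1 $ k = g j $ m * \<nu> m" "axis k 1 $ k = g k $ m * \<nu> m"
        using Lg by metis+
      then show False using j by (simp add: axis_def)
    qed
    then obtain i where i: "i \<noteq> m" "\<nu> i \<noteq> 0" by blast
    then have i1: "\<nu>1 i \<noteq> 0" "\<nu>1 i = \<nu> i" using eq by auto
    have "(\<forall>i. 0 \<le> \<nu> i) \<longleftrightarrow> (\<forall>i. 0 \<le> \<nu>1 i)" "(\<forall>i. \<nu> i \<le> 0) \<longleftrightarrow> (\<forall>i. \<nu>1 i \<le> 0)"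
      using \<nu>sign i i1 by (metis order_antisym)+
    then show ?thesis using IH Lh by simp
  next
    case False
    have xm: "x $ m = L x $ k * g k $ m" for x
    proof -
      have "x $ m = (\<Sum>l\<in>UNIV. L x $ l *\<^sub>R g l) $ m"
        unfolding L_def g_def by (rule arg_cong[OF dual_basis_expansion[OF D]])
      also have "\<dots> = (\<Sum>l\<in>UNIV. L x $ l * g l $ m)" by simp
      also have "\<dots> = L x $ k * g k $ m"
        using False by (subst sum.remove[of _ k]) (auto intro!: sum.neutral)
      finally show ?thesis .
    qed
    have ym: "y $ m = - (L1 y $ k * g k $ m)" for y
    proof -
      have "y $ m = (\<Sum>l\<in>UNIV. L1 y $ l *\<^sub>R g1 l) $ m"
        unfolding L1_def g1_def by (rule arg_cong[OF dual_basis_expansion[OF D1]])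
      also have "\<dots> = (\<Sum>l\<in>UNIV. L1 y $ l * - (g l $ m))" by (simp add: g1 mutation_map_nth)
      also have "\<dots> = L1 y $ k * - (g k $ m)"
        using False by (subst sum.remove[of _ k]) (auto intro!: sum.neutral)
      finally show ?thesis by simp
    qed
    have one: "\<nu> m * g k $ m = 1" using xm[of "axis m 1"] by (simp add: \<nu>L)
    have "\<nu> m \<in> \<int>" "g k $ m \<in> \<int>"
      unfolding \<nu>_def g_def by (rule normal_Ints[OF symB], rule chart_ray_Ints[OF symB])
    then obtain a b where ab: "\<nu> m = of_int a" "g k $ m = of_int b" by (auto elim!: Ints_cases)
    then have "a * b = 1" using one by (metis of_int_eq_1_iff of_int_mult)
    then have "(a = 1 \<and> b = 1) \<or> (a = -1 \<and> b = -1)" by (rule zmult_eq_1_iff[THEN iffD1])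
    then obtain \<tau> :: int where \<tau>: "\<tau> = 1 \<or> \<tau> = -1" "\<nu> m = of_int \<tau>" "g k $ m = of_int \<tau>"
      using ab by auto
    \<comment> \<open>Rays and normals are integral also with respect to \<open>d\<close>, so \<open>d m\<close> and \<open>d k\<close> divide each other.\<close>
    have dmk: "d m = d k"
    proof -
      have "of_int (d k) * g k $ m / of_int (d m) \<in> \<int>"
        unfolding g_def by (rule chart_ray_scaled_Ints[OF symB])
      moreover have "of_int (d m) * \<nu> m / of_int (d k) \<in> \<int>"
        unfolding \<nu>_def by (rule normal_scaled_Ints[OF symB])
      ultimately have "real_of_int (d k) / of_int (d m) \<in> \<int>" "real_of_int (d m) / of_int (d k) \<in> \<int>"
        using \<tau> Ints_minus by fastforce+
      then have "d m dvd d k" "d k dvd d m"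
        using dvd_of_ratio_Ints symmetrizesD(1)[OF symB] by blast+
      with symmetrizesD(1)[OF symB, of m] symmetrizesD(1)[OF symB, of k] show ?thesis
        by (simp add: zdvd_antisym_nonneg)
    qed
    have \<nu>i: "\<nu> i = (if i = m then of_int \<tau> else 0)" for i
      using xm[of "axis i 1"] \<tau> by (auto simp: \<nu>L axis_def)
    have \<nu>1i: "\<nu>1 i = (if i = m then - of_int \<tau> else 0)" for i
      using ym[of "axis i 1"] \<tau> by (auto simp: \<nu>1L axis_def)
    have "L1 (\<Sum>i\<in>UNIV. (\<nu>1 i * of_int (d i)) *\<^sub>R real_vec (B1 $ i)) = of_int (d k) *\<^sub>R real_vec (Bt $ k)"
      unfolding L1_def \<nu>1_def Bt_def by (rule linear_extension_rows[OF B1])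
    also have "(\<Sum>i\<in>UNIV. (\<nu>1 i * of_int (d i)) *\<^sub>R real_vec (B1 $ i))
        = (- of_int \<tau> * of_int (d m)) *\<^sub>R real_vec (B1 $ m)"
      unfolding \<nu>1i by (subst sum.remove[of _ m]) (auto intro!: sum.neutral)
    finally have "(- of_int \<tau> * of_int (d k)) *\<^sub>R L1 (real_vec (B1 $ m)) = of_int (d k) *\<^sub>R real_vec (Bt $ k)"
      unfolding dmk linear_scale[OF linL1] .
    then have "of_int (d k) *\<^sub>R (- of_int \<tau> *\<^sub>R L1 (real_vec (B1 $ m))) = of_int (d k) *\<^sub>R real_vec (Bt $ k)"
      by (simp add: mult.commute)
    then have row: "- of_int \<tau> *\<^sub>R L1 (real_vec (B1 $ m)) = real_vec (Bt $ k)"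
      using symmetrizesD(1)[OF symB, of k] by (metis less_irrefl of_int_eq_0_iff scaleR_cancel_left)
    have B1m: "real_vec (B1 $ m) = - real_vec (B $ m)"
      by (simp add: vec_eq_iff real_vec_def B1_def mutate_nth)
    have mm: "B $ m $ m = 0" by (rule diagonal_zero[OF symB])
    have g0: "g l $ m = (if l = k then of_int \<tau> else 0)" for l using False \<tau> by auto
    have Lp: "L x = L1 (mutation_piece \<tau> B m x)" for x
      by (rule piece) (use \<tau>(1) g0 in auto)
    have L1h1: "L1 h1 $ k = -1"
      using IH \<nu>sign(2) wk kk by auto
    have hm: "h $ m = - of_int \<tau>"
      using ym[of h1] L1h1 \<tau> by (simp add: h1 mutation_map_nth)
    have "mutation_piece \<tau> B m h = h1 + real_vec (B1 $ m)"
    proof (cases "\<tau> = 1")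
      case True
      then show ?thesis
        using mutation_piece_diff[where a = h and B = B and k = m, OF mm] hm
        by (simp add: h1 mutation_map_nonpos B1m)
    next
      case False
      then have "\<tau> = -1" using \<tau> by simp
      then show ?thesis
        using mutation_piece_diff[where a = h and B = B and k = m, OF mm] hm
        by (simp add: h1 mutation_map_nonneg B1m)
    qed
    then have Lh: "L h = L1 h1 + L1 (real_vec (B1 $ m))"
      by (simp add: Lp linear_add[OF linL1])
    have row': "L1 (real_vec (B1 $ m)) = - of_int \<tau> *\<^sub>R real_vec (Bt $ k)"
      unfolding row[symmetric] using \<tau>(1) by auto
    show ?thesis
    proof (cases "\<tau> = 1")
      case True
      then have "L1 h1 = w + real_vec (Bt $ k)" "\<not> (\<forall>i. \<nu> i \<le> 0)"
        using IH by (auto simp: \<nu>1i \<nu>i)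
      moreover from this have "L h = w" using Lh True by (simp add: row')
      ultimately show ?thesis by blast
    next
      case False
      then have t: "\<tau> = -1" using \<tau> by simp
      then have "L1 h1 = w" "\<not> (\<forall>i. 0 \<le> \<nu> i)"
        using IH by (auto simp: \<nu>1i \<nu>i)
      moreover from this have "L h = w + real_vec (Bt $ k)" using Lh t by (simp add: row')
      ultimately show ?thesis by blast
    qed
  qed
  then show ?case
    unfolding \<nu>_def L_def h_def w_def Bt append_Cons .
qed

text \<open>
  A further mutation at the end of the path replaces one ray. The wall crossing lemma gives the value of
  the old linear extension at the new ray, and the piece of the last mutation that acts on \<open>-O\<close> corrects
  precisely the bend that this lemma reports.
\<close>

lemma dual_basis:
  assumes "sign_coherent d B"
  shows "dual_basis B ks"
  using assms
proof (induction "length ks" arbitrary: B ks rule: less_induct)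
  case less
  show ?case
  proof (cases ks rule: rev_cases)
    case Nil
    then show ?thesis by (simp add: dual_basis_def del: linear_extension_axis)
  next
    case (snoc us k)
    have dual: "dual_basis B' vs" if "sign_coherent d B'" "length vs \<le> length us" for B' vs
      using less.hyps[of vs B'] that snoc by simp
    note B = less.prems
    note symB = sign_coherent_symmetrizes[OF B]
    let ?B = "fold mutate us B"
    note W = wall_crossing[OF dual B, where k = k]
    obtain s :: int where s: "(s = -1 \<and> (\<forall>i. 0 \<le> normal B us k i)) \<or> (s = 1 \<and> (\<forall>i. normal B us k i \<le> 0))"
      using normal_sign[OF B, of us k] by metis
    have kk: "?B $ k $ k = 0" by (rule diagonal_zero[OF symmetrizes_fold_mutate[OF symB]])
    have "linear_extension B (us @ [k]) (chart_ray B (us @ [k]) l) = axis l 1" for l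
    proof (cases "l = k")
      case False
      have "linear_extension B us (chart_ray B us l) = axis l 1" using dual[OF B order_refl] by (simp only: dual_basis_def)
      then show ?thesis
        unfolding linear_extension_snoc[OF s] chart_ray_snoc_other[OF False]
        using False by (simp only:) (simp add: vec_eq_iff mutation_piece_def axis_def)
    next
      case True
      have "linear_extension B us (chart_ray B (us @ [k]) k) = (if s = 1 then opposite_ray ?B k + real_vec (?B $ k) else opposite_ray ?B k)"
        using W s by auto
      then show ?thesis
        unfolding linear_extension_snoc[OF s] True
        using s kk by (simp only:) (auto simp: vec_eq_iff mutation_piece_def axis_def opposite_ray_def real_vec_def max_def)
    qed
    then show ?thesis by (simp only: snoc dual_basis_def simp_thms)
  qed
qed

section \<open>The g-vectors are the rays of the cones\<close>

lemma mutate_transpose: "mutate k (transpose B) = transpose (mutate k B)"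
proof -
  have "sgn y * max (x * y) 0 = sgn x * max (y * x) 0" for x y :: int
    by (cases x "0::int" rule: linorder_cases; cases y "0::int" rule: linorder_cases)
      (auto simp: mult_le_0_iff max_def sgn_if zero_le_mult_iff)
  then show ?thesis by (auto simp: vec_eq_iff mutate_nth transpose_def)
qed

lemma principal_matrix_top:
  "principal_matrix (transpose B) t $ Inl i $ j = fold mutate (rev t) B $ j $ i"
proof -
  have "(\<chi> i. principal_matrix (transpose B) t $ Inl i) = transpose (fold mutate (rev t) B)"
  proof (induction t)
    case Nil
    then show ?case by (simp add: vec_eq_iff)
  next
    case (Cons k t)
    have "(\<chi> i. principal_matrix (transpose B) (k # t) $ Inl i)
        = mutate k (\<chi> i. principal_matrix (transpose B) t $ Inl i)"
      by (simp add: vec_eq_iff mutate_nth mutate_ext_def mutate_rows_def)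
    then show ?case by (simp add: Cons mutate_transpose)
  qed
  then show ?thesis by (simp add: vec_eq_iff transpose_def)
qed

text \<open>
  The lower half of the principal matrix consists of the c-vectors of the transposed matrix. Its rows
  mutate like vectors, and transposition acts on exchange matrices as negation up to rescaling by \<open>d\<close>;
  hence the vectors involved are the images of the negative unit vectors.
\<close>

lemma principal_matrix_bottom:
  assumes B: "symmetrizes d B"
  shows "of_int (d j * principal_matrix (transpose B) t $ Inr i $ j) = of_int (d i) * normal B (rev t) j i"
proof (induction t arbitrary: j)
  case Nil
  then show ?case by (auto simp: normal_def mat_def axis_def)
next
  case (Cons k t)
  let ?B = "fold mutate (rev t) B"
  let ?c = "\<lambda>j. principal_matrix (transpose B) t $ Inr i $ j"
  define a where "a = mutation_map_seq B (rev t) (- axis i 1)"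
  have IH: "of_int (d j * ?c j) = - of_int (d i) * a $ j" for j
    using Cons[of j] by (simp add: normal_def a_def)
  note D = symmetrizesD[OF symmetrizes_fold_mutate[OF B, of "rev t"]]
  have new: "normal B (rev (k # t)) j i = - (mutation_map ?B k a $ j)"
    by (simp add: normal_def a_def mutation_map_seq_snoc)
  show ?case
  proof (cases "j = k")
    case True
    then show ?thesis
      using IH[of k] unfolding new
      by (simp add: mutate_ext_def mutate_rows_def mutation_map_nth)
  next
    case False
    define s :: int where "s = (if 0 \<le> a $ k then 1 else -1)"
    have e: "sgn (?B $ j $ k) * max (?c k * ?B $ j $ k) 0 = ?c k * max (- s * ?B $ j $ k) 0"
    proof -
      have "0 \<le> s * (- ?c k)"
      proof -
        have "real_of_int (d k * ?c k * s) = of_int (d k * ?c k) * of_int s"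
          by (simp only: of_int_mult)
        also have "\<dots> = - (of_int (d i) * (a $ k * of_int s))"
          unfolding IH by (simp only: mult.assoc mult_minus_left)
        also have "\<dots> \<le> 0"
          using D(1)[of i] by (simp add: s_def)
        finally have "real_of_int (d k * ?c k * s) \<le> 0" .
        then have "d k * (?c k * s) \<le> 0" by (simp only: of_int_le_0_iff mult.assoc)
        then show ?thesis using D(1)[of k] by (simp add: mult_le_0_iff mult.commute)
      qed
      then have "max (s * ?c k) 0 = 0" by simp
      then show ?thesis using mutation_term[of "-s" "?B $ j $ k" "?c k"] by (simp add: s_def)
    qed
    have "d k * (s * ?B $ k $ j) = - (d j * (s * ?B $ j $ k))"
      using arg_cong[OF D(2)[of k j], of "\<lambda>u. s * u"] by (simp add: mult_ac)
    from scaled_pos_part[OF this D(1) D(1)]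
    have f: "d j * max (- s * ?B $ j $ k) 0 = d k * max (s * ?B $ k $ j) 0" by simp
    have "d j * (principal_matrix (transpose B) (k # t) $ Inr i $ j)
        = d j * ?c j + d j * (?c k * max (- s * ?B $ j $ k) 0)"
      using False by (simp add: mutate_ext_def mutate_rows_def principal_matrix_top e distrib_left)
    also have "\<dots> = d j * ?c j + (d k * ?c k) * max (s * ?B $ k $ j) 0"
      using arg_cong[OF f, of "\<lambda>u. ?c k * u"] by (simp only: mult_ac)
    finally have "real_of_int (d j * (principal_matrix (transpose B) (k # t) $ Inr i $ j))
        = of_int (d j * ?c j) + of_int (d k * ?c k) * of_int (max (s * ?B $ k $ j) 0)" by (simp only: of_int_add of_int_mult)
    also have "\<dots> = - of_int (d i) * (a $ j + a $ k * of_int (max (s * ?B $ k $ j) 0))"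
      unfolding IH by (simp add: algebra_simps)
    also have "a $ j + a $ k * of_int (max (s * ?B $ k $ j) 0) = mutation_map ?B k a $ j"
      using False by (auto simp: s_def mutation_map_nonneg mutation_map_nonpos mutation_piece_def)
    finally show ?thesis unfolding new by simp
  qed
qed

lemma real_vec_simps:
  "real_vec (a + b) = real_vec a + real_vec b"
  "real_vec (a - b) = real_vec a - real_vec b"
  "real_vec (- a) = - real_vec a"
  "real_vec (z *s a) = of_int z *\<^sub>R real_vec a"
  by (simp_all add: vec_eq_iff real_vec_def)

lemma real_vec_sum: "real_vec (\<Sum>i\<in>A. f i) = (\<Sum>i\<in>A. real_vec (f i))"
  by (simp add: vec_eq_iff real_vec_def)

text \<open>
  By sign coherence the c-vector in the recursion is nonnegative or nonpositive. In the latter case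
  its term drops out; in the former the linear extension sends its term to the row \<open>k\<close> of the mutated
  matrix. In both cases the recursion has the image under the injective linear extension
  that the wall crossing lemma gives for the ray.
\<close>

lemma g_vector_eq_chart_ray:
  assumes B: "sign_coherent d B"
  shows "real_vec (g_vector (transpose B) t l) = chart_ray B (rev t) l"
proof (induction t arbitrary: l)
  case Nil
  then show ?case by (simp add: vec_eq_iff real_vec_def axis_def)
next
  case (Cons k t)
  note symB = sign_coherent_symmetrizes[OF B]
  let ?ks = "rev t" and ?B = "fold mutate (rev t) B"
  note kk = diagonal_zero[OF symmetrizes_fold_mutate[OF symB, of ?ks]]
  show ?case
  proof (cases "l = k")
    case False
    then show ?thesis using Cons chart_ray_snoc_other[OF False] by simp
  next
    case True
    let ?L = "linear_extension B ?ks"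
    let ?c = "\<lambda>i. principal_matrix (transpose B) t $ Inr i $ k"
    note L = linear_linear_extension[of B ?ks]
    note D = dual_basis[OF B, of ?ks]
    have Lg: "?L (chart_ray B ?ks l) = axis l 1" for l
      using D by (simp only: dual_basis_def)
    have W: "((\<forall>i. 0 \<le> normal B ?ks k i) \<longrightarrow> ?L (chart_ray B (?ks @ [k]) k) = opposite_ray ?B k) \<and>
      ((\<forall>i. normal B ?ks k i \<le> 0) \<longrightarrow> ?L (chart_ray B (?ks @ [k]) k) = opposite_ray ?B k + real_vec (?B $ k))"
      by (rule wall_crossing[OF dual_basis B])
    have dk: "0 < real_of_int (d k)" for k using symmetrizesD(1)[OF symB] by simp
    have c: "of_int (?c i) = of_int (d i) * normal B ?ks k i / of_int (d k)" for i
      using principal_matrix_bottom[OF symB, of k t i] dk[of k] by (simp add: field_simps)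
    have g: "real_vec (g_vector (transpose B) (k # t) k) =
        - chart_ray B ?ks k + (\<Sum>i\<in>UNIV. of_int (max (?B $ k $ i) 0) *\<^sub>R chart_ray B ?ks i)
        - (\<Sum>i\<in>UNIV. of_int (max (?c i) 0) *\<^sub>R real_vec (B $ i))"
    proof -
      have "column i (transpose B) = B $ i" for i
        by (simp add: vec_eq_iff column_def transpose_def)
      then show ?thesis
        by (simp add: real_vec_simps real_vec_sum Cons principal_matrix_top)
    qed
    have Lpos: "?L (- chart_ray B ?ks k + (\<Sum>i\<in>UNIV. of_int (max (?B $ k $ i) 0) *\<^sub>R chart_ray B ?ks i))
        = opposite_ray ?B k + real_vec (?B $ k)"
    proof -
      have "?L (- chart_ray B ?ks k + (\<Sum>i\<in>UNIV. of_int (max (?B $ k $ i) 0) *\<^sub>R chart_ray B ?ks i))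
         = - axis k 1 + (\<Sum>i\<in>UNIV. of_int (max (?B $ k $ i) 0) *\<^sub>R axis i 1)"
        by (simp only: linear_add[OF L] linear_neg[OF L] linear_sum[OF L] linear_scale[OF L] Lg)
      also have "\<dots> = - axis k 1 + (\<chi> i. of_int (max (?B $ k $ i) 0))"
        using sum_axis[of "\<chi> i. real_of_int (max (?B $ k $ i) 0)"] by simp
      also have "\<dots> = opposite_ray ?B k + real_vec (?B $ k)"
        using kk by (auto simp: vec_eq_iff opposite_ray_def real_vec_def axis_def max_def)
      finally show ?thesis .
    qed
    have "?L (real_vec (g_vector (transpose B) (k # t) k)) = ?L (chart_ray B (?ks @ [k]) k)"
      using normal_sign[OF B, of ?ks k]
    proof
      assume neg: "\<forall>i. normal B ?ks k i \<le> 0"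
      have "?c i \<le> 0" for i
      proof -
        have "real_of_int (?c i) \<le> 0"
          unfolding c using neg dk less_imp_le[OF dk] by (intro divide_nonpos_pos mult_nonneg_nonpos) auto
        then show ?thesis by simp
      qed
      then have "(\<Sum>i\<in>UNIV. of_int (max (?c i) 0) *\<^sub>R real_vec (B $ i)) = 0"
        by (intro sum.neutral) simp
      then have "?L (real_vec (g_vector (transpose B) (k # t) k)) = opposite_ray ?B k + real_vec (?B $ k)"
        by (simp only: g diff_zero Lpos)
      also have "\<dots> = ?L (chart_ray B (?ks @ [k]) k)" using W neg by (simp only: simp_thms)
      finally show ?thesis .
    next
      assume pos: "\<forall>i. 0 \<le> normal B ?ks k i"
      have "0 \<le> ?c i" for i
      proof -
        have "0 \<le> real_of_int (?c i)"
          unfolding c using pos less_imp_le[OF dk] by (intro divide_nonneg_nonneg mult_nonneg_nonneg) auto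
        then show ?thesis by simp
      qed
      then have "(\<Sum>i\<in>UNIV. of_int (max (?c i) 0) *\<^sub>R real_vec (B $ i))
          = (\<Sum>i\<in>UNIV. of_int (?c i) *\<^sub>R real_vec (B $ i))" by simp
      also have "\<dots> = (1 / of_int (d k)) *\<^sub>R (\<Sum>i\<in>UNIV. (normal B ?ks k i * of_int (d i)) *\<^sub>R real_vec (B $ i))"
        unfolding c by (simp add: scaleR_sum_right mult.commute)
      also have "?L \<dots> = (1 / of_int (d k)) *\<^sub>R (of_int (d k) *\<^sub>R real_vec (?B $ k))"
        by (simp only: linear_scale[OF L] linear_extension_rows[OF B])
      also have "\<dots> = real_vec (?B $ k)" using dk[of k] by simp
      finally have "?L (real_vec (g_vector (transpose B) (k # t) k)) = opposite_ray ?B k"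
        by (simp only: g linear_diff[OF L] Lpos add_diff_cancel_right')
      also have "\<dots> = ?L (chart_ray B (?ks @ [k]) k)" using W pos by (simp only: simp_thms)
      finally show ?thesis .
    qed
    from linear_extension_inj[OF D this] show ?thesis using True by simp
  qed
qed

section \<open>Linear independence\<close>

text \<open>
  Every step \<open>m\<close> of a guided path is negative on \<open>-O\<close>. The row \<open>k\<close> starts in \<open>-O\<close> and moves by mutation
  maps, so its entry \<open>m\<close> is nonpositive at that time, the entry in the transposed position is
  nonnegative, and the mutation at a negative coordinate leaves coordinate \<open>k\<close> unchanged.
\<close>

lemma guided_path_keeps_coordinate:
  assumes B: "sign_coherent d B" and sink: "\<And>j. B $ k $ j \<le> 0"
    and "k \<notin> set ks" "directed 1 B ks x" "directed 1 B ks (- 1)"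
  shows "mutation_map_seq B ks x $ k = x $ k"
  using assms(3-)
proof (induction ks rule: rev_induct)
  case (snoc m ks)
  let ?B = "fold mutate ks B"
  note symB = sign_coherent_symmetrizes[OF B]
  have xm: "mutation_map_seq B ks x $ m < 0" and ym: "mutation_map_seq B ks (- 1) $ m < 0"
    using snoc.prems by (auto simp: directed_append)
  have "- 1 \<in> uminus ` (nonneg_orthant :: (real ^ 'a) set)"
    by (auto simp: nonneg_orthant_def)
  then have "\<forall>a\<in>uminus ` nonneg_orthant. mutation_map_seq B ks a $ m \<le> 0"
    using sign_coherentD(2)[OF B, of ks m] ym unfolding same_sign_on_def by (metis not_le)
  moreover have "real_vec (B $ k) \<in> uminus ` nonneg_orthant"
    using sink by (intro image_eqI[of _ _ "- real_vec (B $ k)"]) (auto simp: nonneg_orthant_def real_vec_def)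
  ultimately have "mutation_map_seq B ks (real_vec (B $ k)) $ m \<le> 0" by blast
  then have "?B $ k $ m \<le> 0"
    using mutation_map_seq_row[OF symB, of k ks] snoc.prems(1) by (simp add: real_vec_def)
  then have "0 \<le> ?B $ m $ k"
    using sign_transpose_le[OF symmetrizes_fold_mutate[OF symB]] by blast
  then have "mutation_map_seq B (ks @ [m]) x $ k = mutation_map_seq B ks x $ k"
    using xm snoc.prems(1)
    by (auto simp: mutation_map_seq_snoc mutation_map_nonpos mutation_piece_def max_def)
  then show ?case using snoc by (simp add: directed_append)
qed auto

text \<open>
  Cones intersect in faces, as far as rays are concerned. If a nonnegative combination of vectors with
  coherent signs is a unit vector, then the vectors that occur in it are multiples of this
  unit vector, and integrality leaves only the multiple 1.
\<close>

lemma ray_in_orthant: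
  assumes B: "sign_coherent d B" and z: "z \<in> nonneg_orthant" "0 < z $ k"
    and ray: "mutation_map_seq B ws z = axis l 1"
  shows "z = axis k 1"
proof -
  note symB = sign_coherent_symmetrizes[OF B]
  let ?\<Phi> = "mutation_map_seq B ws"
  let ?\<Psi> = "mutation_map_seq (fold mutate ws B) (rev ws)"
  have inv: "?\<Psi> (?\<Phi> a) = a" for a by (rule mutation_map_seq_rev)
  have sum: "axis l 1 $ i = (\<Sum>j\<in>UNIV. z $ j * ?\<Phi> (axis j 1) $ i)" for i
    unfolding ray[symmetric] mutation_map_seq_orthant[OF B z(1)] by simp
  have z0: "0 \<le> z $ j" for j using z(1) by (simp add: nonneg_orthant_def)
  have sign: "(\<forall>j. 0 \<le> ?\<Phi> (axis j 1) $ i) \<or> (\<forall>j. ?\<Phi> (axis j 1) $ i \<le> 0)" for i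
    using sign_coherentD(1)[OF B, of ws i] axis_in_orthant unfolding same_sign_on_def by blast
  have off: "?\<Phi> (axis k 1) $ i = 0" if "i \<noteq> l" for i
  proof -
    have s0: "(\<Sum>j\<in>UNIV. z $ j * ?\<Phi> (axis j 1) $ i) = 0"
      using sum[of i] that by (simp add: axis_def)
    from sign[of i] have "z $ k * ?\<Phi> (axis k 1) $ i = 0"
    proof
      assume "\<forall>j. 0 \<le> ?\<Phi> (axis j 1) $ i"
      then show ?thesis
        using s0 z0 by (subst (asm) sum_nonneg_eq_0_iff) auto
    next
      assume "\<forall>j. ?\<Phi> (axis j 1) $ i \<le> 0"
      moreover have "(\<Sum>j\<in>UNIV. z $ j * - ?\<Phi> (axis j 1) $ i) = 0"
        using s0 by (simp add: sum_negf)
      ultimately show ?thesis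
        using z0 by (subst (asm) sum_nonneg_eq_0_iff) (auto simp: mult_nonneg_nonpos)
    qed
    then show ?thesis using z(2) by simp
  qed
  define c where "c = ?\<Phi> (axis k 1) $ l"
  have \<Phi>k: "?\<Phi> (axis k 1) = c *\<^sub>R axis l 1"
    using off by (auto simp: vec_eq_iff c_def axis_def)
  have "\<not> (\<forall>j. ?\<Phi> (axis j 1) $ l \<le> 0)"
  proof
    assume "\<forall>j. ?\<Phi> (axis j 1) $ l \<le> 0"
    then have "(\<Sum>j\<in>UNIV. z $ j * ?\<Phi> (axis j 1) $ l) \<le> 0"
      using z0 by (intro sum_nonpos mult_nonneg_nonpos) auto
    then show False using sum[of l] by simp
  qed
  then have c0: "0 \<le> c" using sign[of l] by (auto simp: c_def)
  have "axis k 1 = ?\<Psi> (c *\<^sub>R axis l 1)" using inv[of "axis k 1"] by (simp only: \<Phi>k)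
  also have "\<dots> = c *\<^sub>R ?\<Psi> (axis l 1)" by (rule mutation_map_seq_scaleR[OF c0])
  also have "?\<Psi> (axis l 1) = z" using inv[of z] by (simp only: ray)
  finally have cz: "axis k 1 = c *\<^sub>R z" .
  have "c \<in> \<int>" unfolding c_def by (rule mutation_map_seq_Ints[OF symB]) (auto simp: axis_def)
  moreover have "z $ k \<in> \<int>"
  proof -
    have "z = ?\<Psi> (axis l 1)" using inv[of z] by (simp only: ray)
    moreover have "?\<Psi> (axis l 1) $ k \<in> \<int>"
      by (rule mutation_map_seq_Ints[OF symmetrizes_fold_mutate[OF symB]]) (auto simp: axis_def)
    ultimately show ?thesis by simp
  qed
  moreover have "c * z $ k = 1"
    using arg_cong[OF cz, of "\<lambda>a. a $ k"] by simp
  ultimately have "c = 1"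
  proof -
    assume *: "c \<in> \<int>" "z $ k \<in> \<int>" "c * z $ k = 1"
    obtain p q where pq: "c = of_int p" "z $ k = of_int q" using * by (auto elim!: Ints_cases)
    then have "p * q = 1" using *(3) by (metis of_int_eq_1_iff of_int_mult)
    then have "p = 1" using c0 pq(1) by (auto simp: zmult_eq_1_iff)
    then show "c = 1" using pq by simp
  qed
  then show ?thesis using cz by simp
qed

text \<open>
  If row \<open>k\<close> has no positive entry, then the half-space \<open>x\<^sub>k \<ge> 0\<close> is the union of the cones that
  contain the unit vector of \<open>k\<close>: a guided path that avoids \<open>k\<close> makes the other coordinates nonnegative
  without changing coordinate \<open>k\<close>.
\<close>

lemma sink_ray:
  assumes B: "sign_coherent d B" and fin: "finite (seeds B)"
    and sink: "\<And>j. fold mutate us B $ k $ j \<le> 0"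
    and ray: "mutation_map_seq (fold mutate us B) ws v = axis l 1" and v: "0 < v $ k"
  shows "v = axis k 1"
proof -
  let ?B = "fold mutate us B"
  have B': "sign_coherent d ?B" by (rule sign_coherent_fold_mutate[OF B])
  obtain ks where ks: "set ks \<subseteq> - {k}" "directed 1 ?B ks v" "directed 1 ?B ks (- 1)"
    and nn: "\<forall>j\<in>- {k}. 0 \<le> mutation_map_seq ?B ks v $ j"
    using guided_path[OF sign_coherent_symmetrizes[OF B] fin, of "- {k}" us v] by blast
  have kks: "k \<notin> set ks" using ks(1) by auto
  define z where "z = mutation_map_seq ?B ks v"
  have zk: "z $ k = v $ k"
    unfolding z_def by (rule guided_path_keeps_coordinate[OF B' sink kks ks(2,3)])
  have z0: "z \<in> nonneg_orthant"
  proof -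
    have "0 \<le> z $ j" for j
    proof (cases "j = k")
      case True
      then show ?thesis using zk v by simp
    next
      case False
      then show ?thesis unfolding z_def by (intro bspec[OF nn]) simp
    qed
    then show ?thesis by (simp add: nonneg_orthant_def)
  qed
  have z1: "0 < z $ k" using zk v by simp
  have "mutation_map_seq (fold mutate ks ?B) (rev ks @ ws) z = axis l 1"
    unfolding mutation_map_seq_append z_def comp_apply
      mutation_map_seq_rev fold_mutate_rev by (rule ray)
  then have "z = axis k 1"
    by (rule ray_in_orthant[OF sign_coherent_fold_mutate[OF B'] z0 z1])
  also have "\<dots> = mutation_map_seq ?B ks (axis k 1)"
    by (rule mutation_map_seq_axis[OF kks, symmetric])
  finally show ?thesis
    unfolding z_def mutation_map_seq_eq_iff .
qed

text \<open>
  The chart is chosen such that \<open>r\<close> is the only ray with a positive coordinate \<open>k\<close>. The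
  relation and its negative parts together yield a relation between positive parts of coordinates, in
  which only the term of \<open>r\<close> survives.
\<close>

lemma chart_rays_independent:
  assumes B: "sign_coherent d B" and fin: "finite (seeds B)"
    and S: "\<And>b. b \<in> S \<Longrightarrow> \<exists>ks l. b = chart_ray B ks l"
    and rel: "coherent_relation B R S c (\<lambda>b. b)" and r: "r \<in> S"
  shows "c r = 0"
proof -
  note symB = sign_coherent_symmetrizes[OF B]
  obtain us k where us: "r = chart_ray B us k" using S r by blast
  let ?Bu = "fold mutate us B"
  note symBu = symmetrizes_fold_mutate[OF symB, of us]
  obtain ks where ks: "set ks \<subseteq> - {k}"
    and row: "\<forall>j\<in>- {k}. 0 \<le> - 1 * mutation_map_seq ?Bu ks (real_vec (?Bu $ k)) $ j"
    using directed_terminates[OF symB fin, of "- {k}" "- 1" us "real_vec (?Bu $ k)"] by blast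
  have kks: "k \<notin> set ks" using ks by auto
  define ps where "ps = us @ ks"
  let ?B = "fold mutate ps B"
  have "?B $ k $ k = 0" by (rule diagonal_zero[OF symmetrizes_fold_mutate[OF symB]])
  moreover have "?B $ k $ j \<le> 0" if "j \<noteq> k" for j
    using bspec[OF row, of j] that unfolding mutation_map_seq_row[OF symBu kks] by (simp add: real_vec_def ps_def)
  ultimately have sink: "?B $ k $ j \<le> 0" for j by (cases "j = k") auto
  let ?F = "mutation_map_seq B ps"
  have Fr: "?F r = axis k 1"
    unfolding ps_def mutation_map_seq_append comp_apply us mutation_map_seq_chart_ray
    by (rule mutation_map_seq_axis[OF kks])
  have Fb: "?F b $ k \<le> 0" if b: "b \<in> S" "b \<noteq> r" for b
  proof (rule ccontr)
    assume "\<not> ?thesis"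
    then have pos: "0 < ?F b $ k" by simp
    obtain ws l where ws: "b = chart_ray B ws l" using S b(1) by blast
    have "mutation_map_seq ?B (rev ps @ ws) (?F b) = axis l 1"
      unfolding mutation_map_seq_append
      by (simp add: mutation_map_seq_rev fold_mutate_rev ws mutation_map_seq_chart_ray)
    from sink_ray[OF B fin sink this pos] have "?F b = ?F r" by (simp only: Fr)
    then have "b = r" by (simp only: mutation_map_seq_eq_iff)
    then show False using b by simp
  qed
  have finS: "finite S" and "(\<Sum>b\<in>S. c b *\<^sub>R ?F b) = 0" "(\<Sum>b\<in>S. c b *\<^sub>R min_vec (?F b)) = 0"
    using rel unfolding coherent_relation_def by blast+
  then have "(\<Sum>b\<in>S. c b * ?F b $ k) = 0" "(\<Sum>b\<in>S. c b * min (?F b $ k) 0) = 0"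
    by (auto simp: vec_eq_iff min_vec_def)
  then have "(\<Sum>b\<in>S. c b * (?F b $ k - min (?F b $ k) 0)) = 0"
    by (simp add: right_diff_distrib sum_subtractf)
  also have "(\<Sum>b\<in>S. c b * (?F b $ k - min (?F b $ k) 0)) = (\<Sum>b\<in>S. if b = r then c r else 0)"
    by (rule sum.cong) (use Fb Fr in \<open>auto simp: min_def\<close>)
  finally show ?thesis using finS r by simp
qed

section \<open>Expansion in the rays of a cone\<close>

lemma chart_expansion:
  assumes B: "sign_coherent d B"
    and z: "mutation_map_seq B ks a \<in> nonneg_orthant" (is "?z \<in> _")
  shows "mutation_map_seq B ls a = (\<Sum>l\<in>UNIV. ?z $ l *\<^sub>R mutation_map_seq B ls (chart_ray B ks l))"
    and "min_vec (mutation_map_seq B ls a)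
      = (\<Sum>l\<in>UNIV. ?z $ l *\<^sub>R min_vec (mutation_map_seq B ls (chart_ray B ks l)))"
proof -
  let ?B = "fold mutate ks B" and ?H = "mutation_map_seq (fold mutate ks B) (rev ks @ ls)"
  have B': "sign_coherent d ?B" by (rule sign_coherent_fold_mutate[OF B])
  have H: "mutation_map_seq B ls (mutation_map_seq ?B (rev ks) x) = ?H x" for x
    by (simp add: mutation_map_seq_append fold_mutate_rev)
  have a: "mutation_map_seq B ls a = ?H ?z"
    unfolding H[symmetric] mutation_map_seq_rev ..
  have ray: "mutation_map_seq B ls (chart_ray B ks l) = ?H (axis l 1)" for l
    unfolding chart_ray_def H ..
  have eq: "?H ?z = (\<Sum>l\<in>UNIV. ?z $ l *\<^sub>R ?H (axis l 1))"
    by (rule mutation_map_seq_orthant[OF B' z])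
  then show "mutation_map_seq B ls a = (\<Sum>l\<in>UNIV. ?z $ l *\<^sub>R mutation_map_seq B ls (chart_ray B ks l))"
    by (simp only: a ray)
  have "min (?H ?z $ j) 0 = (\<Sum>l\<in>UNIV. ?z $ l * min (?H (axis l 1) $ j) 0)" for j
  proof -
    have eqj: "?H ?z $ j = (\<Sum>l\<in>UNIV. ?z $ l * ?H (axis l 1) $ j)"
      unfolding arg_cong[OF eq, of "\<lambda>a. a $ j"] by simp
    consider "\<forall>a\<in>nonneg_orthant. 0 \<le> ?H a $ j" | "\<forall>a\<in>nonneg_orthant. ?H a $ j \<le> 0"
      using sign_coherentD(1)[OF B', of "rev ks @ ls" j] unfolding same_sign_on_def by blast
    then show ?thesis
    proof cases
      case 1
      then have "0 \<le> ?H ?z $ j" "\<And>l. 0 \<le> ?H (axis l 1) $ j" using z axis_in_orthant by blast+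
      then show ?thesis by (simp add: min_absorb2)
    next
      case 2
      then have "?H ?z $ j \<le> 0" "\<And>l. ?H (axis l 1) $ j \<le> 0" using z axis_in_orthant by blast+
      then show ?thesis using eqj by (simp only: min_absorb1)
    qed
  qed
  then show "min_vec (mutation_map_seq B ls a)
      = (\<Sum>l\<in>UNIV. ?z $ l *\<^sub>R min_vec (mutation_map_seq B ls (chart_ray B ks l)))"
    by (simp only: a ray) (simp add: vec_eq_iff min_vec_def)
qed

text \<open>
  A mutation makes the sign of its own coordinate the wrong one for the next step, so directed paths
  are vertices of the tree.
\<close>

lemma directed_distinct_adj: "directed \<sigma> B ks a \<Longrightarrow> distinct_adj ks"
proof (induction ks arbitrary: B a)
  case (Cons k ks)
  show ?case
  proof (cases ks)
    case (Cons m ms)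
    have "m \<noteq> k"
    proof
      assume "m = k"
      then have "\<sigma> * a $ k < 0" "\<sigma> * - (a $ k) < 0"
        using Cons.prems Cons by (auto simp: mutation_map_nth)
      then show False by simp
    qed
    then show ?thesis using Cons.IH Cons.prems Cons by auto
  qed simp
qed simp

lemma inj_chart_ray: "inj (chart_ray B ks)"
proof (rule injI)
  fix k l assume "chart_ray B ks k = chart_ray B ks l"
  then have "axis k 1 = (axis l 1 :: real ^ 'a)"
    using mutation_map_seq_chart_ray by metis
  then show "k = l" by (simp add: axis_eq_axis)
qed

theorem theorem10p12:
  fixes B :: "int ^ 'n ^ 'n" and R :: "real set"
  assumes "exchange_matrix B"
    and "finite_type B"
    and "standard_hypotheses B"
    and "underlying_ring R"
  shows "positive_R_basis R B (g_vectors (transpose B)) (\<lambda>b. b)"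
proof -
  obtain d where "symmetrizes d B"
    using assms(1) unfolding exchange_matrix_def symmetrizes_def by blast
  then have B: "sign_coherent d B" and symB: "symmetrizes d B"
    using standard_hypotheses_sign_coherent assms(3) by blast+
  have fin: "finite (seeds B)"
    using assms(2) unfolding finite_type_def seeds_def .
  let ?G = "g_vectors (transpose B)"
  have G: "\<exists>ks l. b = chart_ray B ks l" if "b \<in> ?G" for b
    using that g_vector_eq_chart_ray[OF B] unfolding g_vectors_def by blast
  have over: "(\<lambda>b. b) ` ?G \<subseteq> vectors_over R"
  proof -
    have "\<int> \<subseteq> R" using assms(4) by (auto simp: underlying_ring_def Ints_def)
    moreover have "b $ j \<in> \<int>" if "b \<in> ?G" for b j
      using G[OF that] chart_ray_Ints[OF symB] by auto
    ultimately show ?thesis unfolding vectors_over_def by blast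
  qed
  have span: "\<exists>S c. finite S \<and> S \<subseteq> ?G \<and> (\<forall>i\<in>S. c i \<in> R \<and> c i > 0) \<and> coherent_expansion B R a S c (\<lambda>b. b)"
    if a: "a \<in> vectors_over R" for a
  proof -
    obtain ks where dir: "directed 1 B ks a" and nn: "\<And>j. 0 \<le> mutation_map_seq B ks a $ j"
      using directed_terminates[OF symB fin, of UNIV 1 "[]" a] unfolding fold_simps mult_1 by blast
    define z where "z = mutation_map_seq B ks a"
    have z: "mutation_map_seq B ks a \<in> nonneg_orthant" using nn by (simp add: nonneg_orthant_def)
    have zR: "z $ l \<in> R" for l
      using mutation_map_seq_over_ring[OF assms(4) symB a, of ks] by (simp add: z_def vectors_over_def)
    note inj = inj_chart_ray[of B ks]
    \<comment> \<open>Rays with coefficient zero are left out, since positivity asks for strictly positive ones.\<close>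
    define P where "P = {l. 0 < z $ l}"
    define S where "S = chart_ray B ks ` P"
    define c where "c b = z $ inv (chart_ray B ks) b" for b
    have c: "c (chart_ray B ks l) = z $ l" for l by (simp add: c_def inj)
    have sumS: "(\<Sum>b\<in>S. c b *\<^sub>R f b) = (\<Sum>l\<in>UNIV. z $ l *\<^sub>R f (chart_ray B ks l))" for f :: "real ^ 'n \<Rightarrow> real ^ 'n"
    proof -
      have "(\<Sum>b\<in>S. c b *\<^sub>R f b) = (\<Sum>l\<in>P. z $ l *\<^sub>R f (chart_ray B ks l))"
        unfolding S_def sum.reindex[OF inj_on_subset[OF inj subset_UNIV]] comp_apply c ..
      also have "\<dots> = (\<Sum>l\<in>UNIV. z $ l *\<^sub>R f (chart_ray B ks l))"
      proof (rule sum.mono_neutral_left)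
        have "z $ l = 0" if "l \<notin> P" for l
          using nn[of l] that by (simp add: P_def z_def)
        then show "\<forall>l\<in>UNIV - P. z $ l *\<^sub>R f (chart_ray B ks l) = 0" by simp
      qed auto
      finally show ?thesis .
    qed
    have "distinct_adj (rev ks)" using directed_distinct_adj[OF dir] by simp
    then have "real_vec (g_vector (transpose B) (rev ks) l) \<in> ?G" for l
      unfolding g_vectors_def tree_vertices_def by blast
    then have "S \<subseteq> ?G"
      unfolding S_def using g_vector_eq_chart_ray[OF B, of "rev ks"] by auto
    moreover have finS: "finite S" by (simp add: S_def)
    moreover have cpos: "\<forall>b\<in>S. c b \<in> R \<and> c b > 0" by (auto simp: S_def c zR P_def)
    moreover have "coherent_expansion B R a S c (\<lambda>b. b)"
    proof -
      have minus: "- x \<in> R" if "x \<in> R" for x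
      proof (cases "R = \<int>")
        case True
        then show ?thesis using that by simp
      next
        case False
        then have "0 \<in> R" "\<forall>x\<in>R. \<forall>y\<in>R. x - y \<in> R"
          using assms(4) unfolding underlying_ring_def by auto
        then have "0 - x \<in> R" using that by blast
        then show ?thesis by simp
      qed
      have oneR: "1 \<in> R" using assms(4) by (auto simp: underlying_ring_def)
      have sums: "(\<Sum>i\<in>insert None (Some ` S). (case i of None \<Rightarrow> 1 | Some b \<Rightarrow> - c b) *\<^sub>R
          f (case i of None \<Rightarrow> a | Some b \<Rightarrow> b)) = f a - (\<Sum>b\<in>S. c b *\<^sub>R f b)"
        for f :: "real ^ 'n \<Rightarrow> real ^ 'n"
        using finS by (simp add: sum.reindex sum_negf)
      show ?thesis
        unfolding coherent_expansion_def coherent_relation_def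
      proof (intro conjI allI ballI)
        fix ls
        show "(\<Sum>i\<in>insert None (Some ` S). (case i of None \<Rightarrow> 1 | Some b \<Rightarrow> - c b) *\<^sub>R
            mutation_map_seq B ls (case i of None \<Rightarrow> a | Some b \<Rightarrow> b)) = 0"
          unfolding sums sumS chart_expansion(1)[OF B z, of ls, folded z_def] by (rule diff_self)
        show "(\<Sum>i\<in>insert None (Some ` S). (case i of None \<Rightarrow> 1 | Some b \<Rightarrow> - c b) *\<^sub>R
            min_vec (mutation_map_seq B ls (case i of None \<Rightarrow> a | Some b \<Rightarrow> b))) = 0"
          unfolding sums[of "\<lambda>x. min_vec (mutation_map_seq B ls x)"]
            sumS[of "\<lambda>x. min_vec (mutation_map_seq B ls x)"]
            chart_expansion(2)[OF B z, of ls, folded z_def] by (rule diff_self)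
      qed (use finS cpos oneR minus in auto)
    qed
    ultimately show ?thesis by blast
  qed
  have indep: "\<forall>i\<in>S. c i = 0" if "S \<subseteq> ?G" "coherent_relation B R S c (\<lambda>b. b)" for S c
    using chart_rays_independent[OF B fin _ that(2)] G that(1) by blast
  have "R_basis R B ?G (\<lambda>b. b)"
    unfolding R_basis_def
  proof (intro conjI ballI allI impI)
    fix a :: "real ^ 'n" assume "a \<in> vectors_over R"
    from span[OF this] show "\<exists>S c. finite S \<and> S \<subseteq> ?G \<and> (\<forall>i\<in>S. c i \<in> R) \<and> coherent_expansion B R a S c (\<lambda>b. b)"
      by blast
  next
    fix S :: "(real ^ 'n) set" and c :: "real ^ 'n \<Rightarrow> real" and i
    assume "finite S \<and> S \<subseteq> ?G \<and> (\<forall>i\<in>S. c i \<in> R) \<and> coherent_relation B R S c (\<lambda>b. b)" "i \<in> S"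
    then show "c i = 0" using indep[of S c] by blast
  qed (rule over)
  then show ?thesis
    unfolding positive_R_basis_def using span by blast
qed

end
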